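(* Let $R(\lambda)\in\mathbb{F}(\lambda)^{p\times m}$ be a rational matrix expressed in the form $R(\lambda)=D(\lambda)+C(\lambda)A(\lambda)^{-1}B(\lambda)$, for some nonsingular polynomial matrix $A(\lambda)\in\mathbb{F}[\lambda]^{n\times n}$ and polynomial matrices $B(\lambda)\in\mathbb{F}[\lambda]^{n\times m}$, $C(\lambda)\in\mathbb{F}[\lambda]^{p\times n}$ and $D(\lambda)\in\mathbb{F}[\lambda]^{p\times m}$. Let $$L_A(\lambda)=\begin{bmatrix} M_A(\lambda)\\ K_A(\lambda)\end{bmatrix}\quad\text{and}\quad L_D(\lambda)=\begin{bmatrix} M_D(\lambda)\\ K_D(\lambda)\end{bmatrix}$$ be strong block minimal basis pencils (linearizations) associated with $A(\lambda)$ and $D(\lambda)$, respectively. Let $N_A(\lambda)$ and $N_D(\lambda)$ be minimal bases dual to $K_A(\lambda)$ and $K_D(\lambda)$, respectively, each with all its row degrees equal, with $M_A(\lambda)N_A(\lambda)^T=A(\lambda)$ and $M_D(\lambda)N_D(\lambda)^T=D(\lambda)$, and denote $\rho_A:=\deg N_A(\lambda)$ and $\rho_D:=\deg N_D(\lambda)$. Consider linear polynomial matrices $M_C(\lambda)\in\mathbb{F}[\lambda]^{p\times(\rho_A+1)n}$ and $M_B(\lambda)\in\mathbb{F}[\lambda]^{n\times(\rho_D+1)m}$ such that $$M_C(\lambda)N_A(\lambda)^T=C(\lambda)\quad\text{and}\quad M_B(\lambda)N_D(\lambda)^T=B(\lambda),$$ and the linear polynomial system matrix $$\mathcal{L}(\lambda)=\left[\begin{array}{c|c}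 M_A(\lambda) & M_B(\lambda)\\ K_A(\lambda) & 0\\ \hline -M_C(\lambda) & M_D(\lambda)\\ 0 & K_D(\lambda)\end{array}\right]$$ with state matrix $L_A(\lambda)$. If the matrices $$\begin{bmatrix}\operatorname{rev}_{\rho_A+1}A(\lambda)\\ \operatorname{rev}_{\rho_A+1}C(\lambda)\end{bmatrix}\quad\text{and}\quad\begin{bmatrix}\operatorname{rev}_{\rho_A+1}A(\lambda)&\operatorname{rev}_{\rho_D+1}B(\lambda)\end{bmatrix}$$ have no eigenvalues at $0$, then $\mathcal{L}(\lambda)$ is a linearization of $R(\lambda)$ at infinity of grade $\rho_D+1$.
   Context: $\mathbb{F}$ is an algebraically closed field (not including infinity); $\mathbb{F}[\lambda]$ and $\mathbb{F}(\lambda)$ are the polynomials and rational functions over $\mathbb{F}$. A polynomial matrix is linear if all its entries have degree at most $1$. For a rational matrix $G(\lambda)$, $\operatorname{rank} G(\lambda)$ is its rank over $\mathbb{F}(\lambda)$, and $\operatorname{rank} G(\lambda_0)$ is the rank over $\mathbb{F}$ of $G(\lambda_0)$. A scalar $\lambda_0\in\mathbb{F}$ is an eigenvalue of a polynomial matrix $G(\lambda)$ if $\operatorname{rank} G(\lambda_0)<\operatorname{rank} G(\lambda)$. A rational matrix is regular at $0$ if it is square and its value at $0$ has finite entries and is invertible. For an integer $g$ and a rational matrix $G(\lambda)$, $\operatorname{rev}_g G(\lambda):=\lambda^g G(1/\lambda)$; for a polynomial matrix $G$, $\operatorname{rev}G:=\operatorname{rev}_{\deg G}G$. Minimal bases: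 a minimal basis of a subspace $\mathcal{V}$ of $\mathbb{F}(\lambda)^{N}$ is a basis of $\mathcal{V}$ consisting of polynomial vectors whose sum of degrees is minimal among all polynomial bases of $\mathcal{V}$. A polynomial matrix with fewer rows than columns is called a minimal basis if its rows form a minimal basis of the subspace they span. Minimal bases $K(\lambda)\in\mathbb{F}[\lambda]^{k\times l}$ and $N(\lambda)\in\mathbb{F}[\lambda]^{q\times l}$ are dual if $k+q=l$ and $K(\lambda)N(\lambda)^T=0$. The $i$th row degree of a polynomial matrix is the degree of its $i$th row. Strong block minimal basis pencil (degenerate form, the only one used here): a linear polynomial matrix $\begin{bmatrix} M(\lambda)\\ K(\lambda)\end{bmatrix}$ where $K(\lambda)$ is a minimal basis with all its row degrees equal to $1$ and the row degrees of a minimal basis $N(\lambda)$ dual to $K(\lambda)$ are all equal. It is associated with a polynomial matrix $P(\lambda)$ (and is then called a strong block minimal basis linearization of $P(\lambda)$) if $M(\lambda)N(\lambda)^T=P(\lambda)$. If $P(\lambda)$ has $c$ columns and $\rho=\deg N(\lambda)$, then $K(\lambda)$ has size $\rho c\times(\rho+1)c$. Polynomial system matrices: for polynomial matrices $\mathsf{A}$ (square, of size $\nu>0$, regular, i.e. $\det\mathsf{A}\not\equiv0$), $\mathsf{B},\mathsf{C},\mathsf{D}$ of compatible sizes, $\begin{bmatrix}\mathsf{A}(\lambda)&\mathsf{B}(\lambda)\\-\mathsf{C}(\lambda)&\mathsf{D}(\lambda)\end{bmatrix}$ is a polynomial system matrix with state matrix $\mathsf{A}(\lambda)$ and transfer function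 matrix $\mathsf{D}(\lambda)+\mathsf{C}(\lambda)\mathsf{A}(\lambda)^{-1}\mathsf{B}(\lambda)$. Linearization at infinity: let $R(\lambda)\in\mathbb{F}(\lambda)^{p\times m}$, let $g$ be an integer, and let $$\mathcal{L}(\lambda)=\left[\begin{array}{c|c}A_1\lambda+A_0&B_1\lambda+B_0\\ \hline -(C_1\lambda+C_0)&D_1\lambda+D_0\end{array}\right]\in\mathbb{F}[\lambda]^{(\nu+p+s)\times(\nu+m+s)}$$ be a nonconstant linear polynomial system matrix with $\nu\times\nu$ state matrix $A_1\lambda+A_0$ and transfer function matrix $\widehat R(\lambda)\in\mathbb{F}(\lambda)^{(p+s)\times(m+s)}$. Then $\mathcal{L}(\lambda)$ is a linearization of $R(\lambda)$ at infinity of grade $g$ if (a) $\operatorname{rev}\mathcal{L}(\lambda)=\lambda\mathcal{L}(1/\lambda)$ (with the same block partition) is minimal at $0$, i.e. the matrices $\begin{bmatrix}\operatorname{rev}_1(A_1\lambda+A_0)\\ \operatorname{rev}_1(C_1\lambda+C_0)\end{bmatrix}$ and $\begin{bmatrix}\operatorname{rev}_1(A_1\lambda+A_0)&\operatorname{rev}_1(B_1\lambda+B_0)\end{bmatrix}$ do not have $0$ as an eigenvalue, and (b) there exist rational matrices $Q_1(\lambda)$ and $Q_2(\lambda)$, both regular at $0$, such that $Q_1(\lambda)\begin{bmatrix}\operatorname{rev}_gR(\lambda)&0\\0&I_s\end{bmatrix}Q_2(\lambda)=\operatorname{rev}_1\widehat R(\lambda)$. *)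

theory Defs
  imports
    "HOL-Computational_Algebra.Polynomial_Factorial"
    "Jordan_Normal_Form.DL_Rank"
    "Jordan_Normal_Form.Gauss_Jordan_Elimination"
begin

text \<open>
  Rational functions over a field \<open>'a\<close> are elements of \<open>'a poly fract\<close>; polynomial and rational
  matrices are \<open>'a poly mat\<close> and \<open>'a poly fract mat\<close>.
\<close>

abbreviation rat_mat :: "'a::field poly mat \<Rightarrow> 'a poly fract mat" where
  "rat_mat \<equiv> map_mat to_fract"

abbreviation rat_vec :: "'a::field poly vec \<Rightarrow> 'a poly fract vec" where
  "rat_vec \<equiv> map_vec to_fract"


subsection \<open>Values of rational functions, and the substitution of $1/\lambda$ for $\lambda$\<close>

definition rat_const :: "'a::field \<Rightarrow> 'a poly fract" where
  "rat_const c = to_fract [:c:]"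

definition rat_X :: "'a::field poly fract" where
  "rat_X = to_fract [:0, 1:]"

definition finite_at :: "'a::field poly fract \<Rightarrow> 'a \<Rightarrow> bool" where
  "finite_at r a \<longleftrightarrow> (\<exists>p q. r = Fract p q \<and> poly q a \<noteq> 0)"

text \<open>The value is unspecified at a pole.\<close>

definition rat_eval :: "'a::field \<Rightarrow> 'a poly fract \<Rightarrow> 'a" where
  "rat_eval a r = (THE c. \<exists>p q. r = Fract p q \<and> poly q a \<noteq> 0 \<and> c = poly p a / poly q a)"

lemma rat_eval_Fract:
  assumes "poly q a \<noteq> 0"
  shows "rat_eval a (Fract p q) = poly p a / poly q a"
  unfolding rat_eval_def
proof (rule the_equality)
  show "\<exists>p' q'. Fract p q = Fract p' q' \<and> poly q' a \<noteq> 0 \<and> poly p a / poly q a = poly p' a / poly q' a"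
    using assms by blast
next
  fix c assume "\<exists>p' q'. Fract p q = Fract p' q' \<and> poly q' a \<noteq> 0 \<and> c = poly p' a / poly q' a"
  then obtain p' q' where h: "Fract p q = Fract p' q'" "poly q' a \<noteq> 0" "c = poly p' a / poly q' a"
    by blast
  have "q \<noteq> 0" "q' \<noteq> 0" using assms h(2) by auto
  with h(1) have "p * q' = p' * q" by (simp add: eq_fract)
  then have "poly p a * poly q' a = poly p' a * poly q a" by (metis poly_mult)
  then show "c = poly p a / poly q a" using assms h(2,3) by (simp add: frac_eq_eq)
qed

lemma rat_eval_to_fract: "rat_eval a (to_fract p) = poly p a"
  using rat_eval_Fract[of 1 a p] by (simp add: to_fract_def)

lemma rat_const_hom [simp]:
  "rat_const 0 = 0" "rat_const (a + b) = rat_const a + rat_const b"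
  "rat_const (a * b) = rat_const a * rat_const b" "rat_const c = 0 \<longleftrightarrow> c = 0"
  by (simp_all add: rat_const_def flip: to_fract_add to_fract_mult)

lemma poly_rat_const_mult:
  "poly (map_poly rat_const (p * q)) x = poly (map_poly rat_const p) x * poly (map_poly rat_const q) x"
proof -
  have add: "map_poly rat_const (p + q) = map_poly rat_const p + map_poly rat_const q" for p q :: "'a poly"
    by (simp add: poly_eq_iff coeff_map_poly)
  have smult: "map_poly rat_const (Polynomial.smult c q) = Polynomial.smult (rat_const c) (map_poly rat_const q)"
    for c and q :: "'a poly"
    by (simp add: poly_eq_iff coeff_map_poly)
  show ?thesis
    by (induction p) (simp_all add: add smult map_poly_pCons algebra_simps)
qed

lemma poly_rat_const_X: "poly (map_poly rat_const p) rat_X = to_fract p"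
proof (induction p)
  case (pCons c p)
  have "to_fract (pCons c p) = rat_const c + rat_X * to_fract p"
    by (simp add: rat_const_def rat_X_def flip: to_fract_add to_fract_mult)
  with pCons show ?case by (simp add: map_poly_pCons)
qed simp

lemma rat_X_nonzero [simp]: "rat_X \<noteq> 0"
  by (simp add: rat_X_def)

lemma poly_rat_const_inverse_X:
  "rat_X ^ degree p * poly (map_poly rat_const p) (inverse rat_X) = to_fract (reflect_poly p)"
proof -
  have deg: "degree (map_poly rat_const p) = degree p"
    by (intro degree_map_poly) simp
  have "reflect_poly (map_poly rat_const p) = map_poly rat_const (reflect_poly p)"
    by (simp add: poly_eq_iff coeff_map_poly coeff_reflect_poly deg)
  with poly_reflect_poly_nz[of rat_X "map_poly rat_const p"] show ?thesis
    by (simp add: deg poly_rat_const_X)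
qed

lemma poly_rat_const_inverse_X_nonzero:
  assumes "p \<noteq> 0"
  shows "poly (map_poly rat_const p) (inverse rat_X) \<noteq> 0"
proof
  assume "poly (map_poly rat_const p) (inverse rat_X) = 0"
  with poly_rat_const_inverse_X[of p] have "to_fract (reflect_poly p) = 0" by simp
  with assms show False by simp
qed

text \<open>\<open>recip_subst r\<close> is $r(1/\lambda)$.\<close>

definition recip_subst :: "'a::field poly fract \<Rightarrow> 'a poly fract" where
  "recip_subst r = (THE s. \<exists>p q. r = Fract p q \<and> q \<noteq> 0 \<and>
     s = poly (map_poly rat_const p) (inverse rat_X) / poly (map_poly rat_const q) (inverse rat_X))"

lemma recip_subst_Fract:
  assumes "q \<noteq> 0"
  shows "recip_subst (Fract p q) =
    poly (map_poly rat_const p) (inverse rat_X) / poly (map_poly rat_const q) (inverse rat_X)"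
  unfolding recip_subst_def
proof (rule the_equality)
  let ?e = "\<lambda>p. poly (map_poly rat_const p) (inverse rat_X)"
  show "\<exists>p' q'. Fract p q = Fract p' q' \<and> q' \<noteq> 0 \<and> ?e p / ?e q = ?e p' / ?e q'"
    using assms by blast
  fix s assume "\<exists>p' q'. Fract p q = Fract p' q' \<and> q' \<noteq> 0 \<and> s = ?e p' / ?e q'"
  then obtain p' q' where h: "Fract p q = Fract p' q'" "q' \<noteq> 0" "s = ?e p' / ?e q'"
    by blast
  with assms have "p * q' = p' * q" by (simp add: eq_fract)
  then have "?e (p * q') = ?e (p' * q)" by simp
  with assms h(2,3) show "s = ?e p / ?e q"
    by (simp add: poly_rat_const_mult poly_rat_const_inverse_X_nonzero frac_eq_eq)
qed

definition rev_mat :: "int \<Rightarrow> 'a::field poly fract mat \<Rightarrow> 'a poly fract mat" where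
  "rev_mat g G = (rat_X powi g) \<cdot>\<^sub>m map_mat recip_subst G"


subsection \<open>Rank, eigenvalues and regularity\<close>

definition mat_rank :: "'a::field mat \<Rightarrow> nat" where
  "mat_rank G = vec_space.rank (dim_row G) G"

text \<open>
  The matrix argument is a rational matrix so that it can be a reversal; the notion is
  used only when all the entries are polynomials.
\<close>

definition is_eigenvalue :: "'a::field poly fract mat \<Rightarrow> 'a \<Rightarrow> bool" where
  "is_eigenvalue G a \<longleftrightarrow> mat_rank (map_mat (rat_eval a) G) < mat_rank G"

definition regular_at_zero :: "'a::field poly fract mat \<Rightarrow> bool" where
  "regular_at_zero Q \<longleftrightarrow> square_mat Q \<and> (\<forall>r \<in> elements_mat Q. finite_at r 0) \<and>
     invertible_mat (map_mat (rat_eval 0) Q)"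


subsection \<open>Degrees\<close>

text \<open>Zero and empty vectors and matrices get degree \<open>0\<close>.\<close>

definition vec_degree :: "'a::zero poly vec \<Rightarrow> nat" where
  "vec_degree v = Max (insert 0 (degree ` set\<^sub>v v))"

definition mat_degree :: "'a::zero poly mat \<Rightarrow> nat" where
  "mat_degree G = Max (insert 0 (degree ` elements_mat G))"

definition row_degree :: "'a::zero poly mat \<Rightarrow> nat \<Rightarrow> nat" where
  "row_degree G i = vec_degree (row G i)"

definition equal_row_degrees :: "'a::zero poly mat \<Rightarrow> bool" where
  "equal_row_degrees G \<longleftrightarrow> (\<exists>d. \<forall>i < dim_row G. row_degree G i = d)"

definition linear_mat :: "'a::zero poly mat \<Rightarrow> bool" where
  "linear_mat G \<longleftrightarrow> (\<forall>p \<in> elements_mat G. degree p \<le> 1)"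


subsection \<open>Minimal bases\<close>

text \<open>
  Linear independence and span are those of $\mathbb{F}(\lambda)^l$, the space
  \<open>module_vec TYPE('a poly fract) l\<close>.
\<close>

definition rat_span :: "nat \<Rightarrow> 'a::field poly vec list \<Rightarrow> 'a poly fract vec set" where
  "rat_span l vs =
     LinearCombinations.module.span class_ring (module_vec TYPE('a poly fract) l) (set (map rat_vec vs))"

definition polynomial_basis :: "nat \<Rightarrow> 'a::field poly fract vec set \<Rightarrow> 'a poly vec list \<Rightarrow> bool" where
  "polynomial_basis l V vs \<longleftrightarrow> set vs \<subseteq> carrier_vec l \<and> distinct vs \<and>
     \<not> LinearCombinations.module.lin_dep class_ring (module_vec TYPE('a poly fract) l) (set (map rat_vec vs)) \<and>
     rat_span l vs = V"

definition minimal_basis :: "nat \<Rightarrow> 'a::field poly fract vec set \<Rightarrow> 'a poly vec list \<Rightarrow> bool" where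
  "minimal_basis l V vs \<longleftrightarrow> polynomial_basis l V vs \<and>
     (\<forall>ws. polynomial_basis l V ws \<longrightarrow>
        sum_list (map vec_degree vs) \<le> sum_list (map vec_degree ws))"

definition minimal_basis_mat :: "'a::field poly mat \<Rightarrow> bool" where
  "minimal_basis_mat K \<longleftrightarrow> dim_row K < dim_col K \<and>
     minimal_basis (dim_col K) (rat_span (dim_col K) (rows K)) (rows K)"

definition dual_minimal_bases :: "'a::field poly mat \<Rightarrow> 'a poly mat \<Rightarrow> bool" where
  "dual_minimal_bases K N \<longleftrightarrow> minimal_basis_mat K \<and> minimal_basis_mat N \<and>
     dim_col N = dim_col K \<and> dim_row K + dim_row N = dim_col K \<and>
     K * transpose_mat N = 0\<^sub>m (dim_row K) (dim_row N)"

text \<open>The pencil is \<open>M @\<^sub>r K\<close>, that is, \<open>M\<close> on top of \<open>K\<close>.\<close>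

definition strong_block_minimal_basis_pencil :: "'a::field poly mat \<Rightarrow> 'a poly mat \<Rightarrow> bool" where
  "strong_block_minimal_basis_pencil M K \<longleftrightarrow> dim_col M = dim_col K \<and> linear_mat (M @\<^sub>r K) \<and>
     minimal_basis_mat K \<and> (\<forall>i < dim_row K. row_degree K i = 1) \<and>
     (\<exists>N. dual_minimal_bases K N \<and> equal_row_degrees N)"


subsection \<open>System matrices and linearizations at infinity\<close>

definition append_cols :: "'a::zero mat \<Rightarrow> 'a mat \<Rightarrow> 'a mat" where
  "append_cols A B = four_block_mat A B (0\<^sub>m 0 (dim_col A)) (0\<^sub>m 0 (dim_col B))"

definition transfer_function ::
    "'a::field poly mat \<Rightarrow> 'a poly mat \<Rightarrow> 'a poly mat \<Rightarrow> 'a poly mat \<Rightarrow> 'a poly fract mat" where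
  "transfer_function A B C D =
     rat_mat D + rat_mat C * the (mat_inverse (rat_mat A)) * rat_mat B"

text \<open>
  The block partition of the system matrix \<open>L\<close> is determined by the size \<open>\<nu>\<close> of its state matrix,
  so the quantified blocks are unique. The lower left block carries the minus sign.
\<close>

definition linearization_at_infinity ::
    "nat \<Rightarrow> 'a::field poly mat \<Rightarrow> 'a poly fract mat \<Rightarrow> int \<Rightarrow> bool" where
  "linearization_at_infinity \<nu> L R g \<longleftrightarrow>
     (let p = dim_row R; m = dim_col R in
      \<exists>s A B C D.
        A \<in> carrier_mat \<nu> \<nu> \<and> B \<in> carrier_mat \<nu> (m + s) \<and>
        C \<in> carrier_mat (p + s) \<nu> \<and> D \<in> carrier_mat (p + s) (m + s) \<and>
        L = four_block_mat A B (- C) D \<and>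
        linear_mat L \<and> mat_degree L \<noteq> 0 \<and> \<nu> > 0 \<and> det A \<noteq> 0 \<and>
        \<not> is_eigenvalue (rev_mat 1 (rat_mat A) @\<^sub>r rev_mat 1 (rat_mat C)) 0 \<and>
        \<not> is_eigenvalue (append_cols (rev_mat 1 (rat_mat A)) (rev_mat 1 (rat_mat B))) 0 \<and>
        (\<exists>Q\<^sub>1 \<in> carrier_mat (p + s) (p + s). \<exists>Q\<^sub>2 \<in> carrier_mat (m + s) (m + s).
           regular_at_zero Q\<^sub>1 \<and> regular_at_zero Q\<^sub>2 \<and>
           Q\<^sub>1 * four_block_mat (rev_mat g R) (0\<^sub>m p s) (0\<^sub>m s m) (1\<^sub>m s) * Q\<^sub>2 =
             rev_mat 1 (transfer_function A B C D)))"

end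

theory Submission
  imports Defs
begin

text \<open>
  Replacing the variable by its inverse moves everything from infinity to zero, and there the
  theorem becomes linear algebra over the rational functions without pole at zero. Write a prime for
  the reversal at the appropriate grade: 1 for the blocks of the pencils, \<open>\<rho>\<close> for a dual basis \<open>N\<close>,
  and \<open>\<rho> + 1\<close> for \<open>A\<close>, \<open>B\<close>, \<open>C\<close>, \<open>D\<close>. Reversal is multiplicative, so \<open>K' N'\<^sup>T = 0\<close>,
  \<open>A' = M\<^sub>A' N\<^sub>A'\<^sup>T\<close> and so on.

  A minimal basis whose rows all have the same degree has linearly independent leading row
  coefficients, for a constant dependence between them would produce a basis of smaller degree
  (\<open>minimal_basis_lead_independent\<close>). Those coefficients are the values at zero of the reversals, so
  \<open>K'\<close> and \<open>N'\<close> have full row rank at zero. Choosing a constant \<open>X\<close> with \<open>K'(0) X = 1\<close>, the matrix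
  \<open>U\<close> with the blocks \<open>N'\<^sup>T\<close> and \<open>X\<close> is invertible at zero, and \<open>K' U\<close> has the blocks \<open>0\<close> and \<open>W\<close>
  with \<open>W(0) = 1\<close> (\<open>dual_completion_field\<close>). In particular the kernel of \<open>K'(0)\<close> is the column space
  of \<open>N'(0)\<^sup>T\<close>.

  \<^bold>\<open>Minimality.\<close> A vector killed by the reversed state and output blocks at zero is killed by
  \<open>K\<^sub>A'(0)\<close>, hence is \<open>N\<^sub>A'(0)\<^sup>T w\<close>, and then \<open>A'(0) w = 0\<close> and \<open>C'(0) w = 0\<close>, which forces \<open>w = 0\<close>
  (\<open>pencil_state_output_injective\<close>). Dually, the reversed state and input blocks map onto everything
  because those of \<open>A'\<close> and \<open>B'\<close> do (\<open>pencil_state_input_surjective\<close>).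

  \<^bold>\<open>Equivalence.\<close> From \<open>L\<^sub>A N\<^sub>A\<^sup>T = [A; 0]\<close> the transfer function of the pencil has the block rows
  \<open>M\<^sub>D + C A\<^sup>-\<^sup>1 M\<^sub>B\<close> and \<open>K\<^sub>D\<close> (\<open>pencil_transfer_function\<close>). Multiplying its reversal by the matrix \<open>U\<close>
  belonging to \<open>K\<^sub>D\<close> gives \<open>[R' Z; 0 W]\<close>.
  Here \<open>Z = (M\<^sub>D' + C' A'\<^sup>-\<^sup>1 M\<^sub>B') X\<close> may have a pole at zero, so it cannot be removed by a row operation
  with \<open>W\<close>. But \<open>[A' B']\<close> has full row rank at zero, so \<open>M\<^sub>B' X = A' F + B' G\<close> for some \<open>F\<close> and \<open>G\<close>
  without pole at zero (\<open>controllable_solve\<close>), and then \<open>Z = R' G + Y\<close> where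
  \<open>Y = M\<^sub>D' X + C' F - D' G\<close> has no pole at zero either (\<open>feedthrough_identity\<close>). The summand \<open>R' G\<close>
  is removed by a column operation and \<open>Y\<close> by a row operation
  (\<open>transfer_function_equivalence_at_zero\<close>).
\<close>

section \<open>Matrices of full rank over a field\<close>

lemma mat_rank_le_dim_row:
  fixes G :: "'a::field mat"
  assumes "G \<in> carrier_mat nr nc"
  shows "mat_rank G \<le> nr"
proof -
  interpret vec_space "TYPE('a)" nr .
  have c: "set (cols G) \<subseteq> carrier_vec nr" using assms cols_dim by blast
  obtain S where S: "maximal S (\<lambda>T. T \<subseteq> set (cols G) \<and> lin_indpt T)"
    using maximal_exists[of "(\<lambda>T. T \<subseteq> set (cols G) \<and> lin_indpt T)" "card (set (cols G))" "{}"]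
    by (meson List.finite_set card_mono empty_iff empty_subsetI finite_lin_indpt2 rev_finite_subset)
  then have "S \<subseteq> set (cols G)" "lin_indpt S" by (auto simp: maximal_def)
  then have "card S \<le> nr" using li_le_dim(2)[of S] c by (auto simp: dim_is_n)
  with rank_card_indpt[OF assms S] show ?thesis using assms by (simp add: mat_rank_def)
qed

lemma mat_rank_le_dim_col:
  fixes G :: "'a::field mat"
  assumes "G \<in> carrier_mat nr nc"
  shows "mat_rank G \<le> nc"
  using vec_space.rank_le_nc[OF assms] assms by (simp add: mat_rank_def)

lemma distinct_cols_if_inj:
  fixes G :: "'a::field mat"
  assumes G: "G \<in> carrier_mat nr nc"
    and inj: "\<And>v. v \<in> carrier_vec nc \<Longrightarrow> G *\<^sub>v v = 0\<^sub>v nr \<Longrightarrow> v = 0\<^sub>v nc"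
  shows "distinct (cols G)"
proof (rule ccontr)
  assume "\<not> distinct (cols G)"
  then obtain i j where ij: "i \<noteq> j" "i < nc" "j < nc" "col G i = col G j"
    using G by (auto simp: distinct_conv_nth)
  let ?v = "unit_vec nc i - unit_vec nc j :: 'a vec"
  have "G *\<^sub>v ?v = G *\<^sub>v unit_vec nc i - G *\<^sub>v unit_vec nc j"
    using G by (intro mult_minus_distrib_mat_vec) auto
  also have "\<dots> = 0\<^sub>v nr"
    using G ij by (intro eq_vecI) (auto simp: vec_eq_iff)
  finally have "?v = 0\<^sub>v nc" using inj[of ?v] by simp
  then have "?v $ i = 0" using ij by simp
  with ij show False by simp
qed

text \<open>If a column were repeated, a maximal independent set of columns would have fewer than \<open>nc\<close>
  elements; so full rank already makes the columns distinct, as the criteria for linear dependence of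
  a set of columns require.\<close>

lemma mat_rank_eq_dim_col_iff:
  fixes G :: "'a::field mat"
  assumes G: "G \<in> carrier_mat nr nc"
  shows "mat_rank G = nc \<longleftrightarrow> (\<forall>v \<in> carrier_vec nc. G *\<^sub>v v = 0\<^sub>v nr \<longrightarrow> v = 0\<^sub>v nc)"
proof -
  interpret vec_space "TYPE('a)" nr .
  have r: "mat_rank G = rank G" using G by (simp add: mat_rank_def)
  show ?thesis
  proof
    assume full: "mat_rank G = nc"
    obtain S where S: "maximal S (\<lambda>T. T \<subseteq> set (cols G) \<and> lin_indpt T)"
      using maximal_exists[of "(\<lambda>T. T \<subseteq> set (cols G) \<and> lin_indpt T)" "card (set (cols G))" "{}"]
      by (meson List.finite_set card_mono empty_iff empty_subsetI finite_lin_indpt2 rev_finite_subset)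
    have "S \<subseteq> set (cols G)" using S by (auto simp: maximal_def)
    moreover have "card S = nc" using rank_card_indpt[OF G S] full r by simp
    ultimately have "nc \<le> card (set (cols G))" by (metis List.finite_set card_mono)
    then have d: "distinct (cols G)"
      using G by (metis card_distinct card_length carrier_matD(2) cols_length le_antisym)
    show "\<forall>v \<in> carrier_vec nc. G *\<^sub>v v = 0\<^sub>v nr \<longrightarrow> v = 0\<^sub>v nc"
      using full_rank_lin_indpt[OF G _ d] lin_depI[OF G _ _ _ d] full r by auto
  next
    assume "\<forall>v \<in> carrier_vec nc. G *\<^sub>v v = 0\<^sub>v nr \<longrightarrow> v = 0\<^sub>v nc"
    then have inj: "\<And>v. v \<in> carrier_vec nc \<Longrightarrow> G *\<^sub>v v = 0\<^sub>v nr \<Longrightarrow> v = 0\<^sub>v nc" by blast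
    have d: "distinct (cols G)" by (rule distinct_cols_if_inj[OF G inj])
    have "lin_indpt (set (cols G))" using lin_depE[OF G _ d] inj by metis
    then show "mat_rank G = nc" using lin_indpt_full_rank[OF G d] r by simp
  qed
qed

lemma mat_rank_eq_dim_row_iff:
  fixes G :: "'a::field mat"
  assumes G: "G \<in> carrier_mat nr nc"
  shows "mat_rank G = nr \<longleftrightarrow> (\<forall>y \<in> carrier_vec nr. \<exists>x \<in> carrier_vec nc. G *\<^sub>v x = y)"
proof -
  interpret vec_space "TYPE('a)" nr .
  have r: "mat_rank G = rank G" using G by (simp add: mat_rank_def)
  have c: "set (cols G) \<subseteq> carrier_vec nr" using G cols_dim by blast
  have cs: "span (set (cols G)) = {y \<in> carrier_vec nr. \<exists>x\<in>carrier_vec nc. G *\<^sub>v x = y}"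
    using col_space_eq[OF G] G by (simp add: col_space_def)
  obtain S where S: "maximal S (\<lambda>T. T \<subseteq> set (cols G) \<and> lin_indpt T)"
    using maximal_exists[of "(\<lambda>T. T \<subseteq> set (cols G) \<and> lin_indpt T)" "card (set (cols G))" "{}"]
    by (meson List.finite_set card_mono empty_iff empty_subsetI finite_lin_indpt2 rev_finite_subset)
  have S': "S \<subseteq> set (cols G)" "lin_indpt S" "finite S"
    using S by (auto simp: maximal_def intro: finite_subset)
  show ?thesis
  proof
    assume full: "mat_rank G = nr"
    have "card S = nr" using rank_card_indpt[OF G S] full r by simp
    then have "basis S" using S' c by (intro dim_li_is_basis) (auto simp: dim_is_n)
    then have "carrier_vec nr \<subseteq> span (set (cols G))"
      using span_is_monotone[OF S'(1)] by (simp add: basis_def)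
    then show "\<forall>y \<in> carrier_vec nr. \<exists>x \<in> carrier_vec nc. G *\<^sub>v x = y"
      using cs by auto
  next
    assume "\<forall>y \<in> carrier_vec nr. \<exists>x \<in> carrier_vec nc. G *\<^sub>v x = y"
    then have "span (set (cols G)) = carrier_vec nr" using cs by auto
    then have "rank G = dim" unfolding rank_def by (simp add: module_vec_def)
    then show "mat_rank G = nr" using r dim_is_n by simp
  qed
qed

text \<open>A zero row in the reduced row echelon form of \<open>K\<close> would be a combination of the rows of \<open>K\<close> and so
  give an element of the left kernel. Hence every row has a pivot, and the pivot columns
  of the echelon form make up an identity matrix.\<close>

lemma right_inverse_if_left_kernel_trivial:
  fixes K :: "'a::field mat"
  assumes K: "K \<in> carrier_mat k l"
    and inj: "\<And>v. v \<in> carrier_vec k \<Longrightarrow> K\<^sup>T *\<^sub>v v = 0\<^sub>v l \<Longrightarrow> v = 0\<^sub>v k"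
  obtains X where "X \<in> carrier_mat l k" "K * X = 1\<^sub>m k"
proof -
  define E where "E = gauss_jordan_single K"
  note gj = gauss_jordan_single[OF K E_def[symmetric]]
  obtain P Q where PQ: "E = P * K" "P \<in> carrier_mat k k" "Q \<in> carrier_mat k k"
    "P * Q = 1\<^sub>m k" "Q * P = 1\<^sub>m k" using gj(4) by blast
  have E: "E \<in> carrier_mat k l" by fact
  obtain f where f: "pivot_fun E f l" using gj(3) E by (auto simp: row_echelon_form_def)
  have dE: "dim_row E = k" using E by simp
  note pf = pivot_funD[OF dE f]
  have fl: "f i < l" if i: "i < k" for i
  proof (rule ccontr)
    assume "\<not> f i < l"
    with pf(1)[OF i] have fi: "f i = l" by simp
    have "row E i = 0\<^sub>v l" using E i fi pf(2)[OF i] by (intro eq_vecI) auto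
    moreover have "row E i = K\<^sup>T *\<^sub>v row P i"
    proof (rule eq_vecI)
      fix j assume "j < dim_vec (K\<^sup>T *\<^sub>v row P i)"
      then show "row E i $ j = (K\<^sup>T *\<^sub>v row P i) $ j"
        using PQ(1,2) K i by (auto intro!: comm_scalar_prod[of _ k])
    qed (use E K in auto)
    ultimately have "row P i = 0\<^sub>v k" using inj[of "row P i"] PQ(2) i by auto
    then have "(P * Q) $$ (i, i) = 0" using PQ(2,3) i by simp
    then show False using PQ(4) i by simp
  qed
  \<comment> \<open>\<open>X\<close> selects the pivot columns.\<close>
  define X where "X = mat l k (\<lambda>(j, i). if j = f i then 1 else 0 :: 'a)"
  have X: "X \<in> carrier_mat l k" by (simp add: X_def)
  have EX: "E * X = 1\<^sub>m k"
  proof (rule eq_matI)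
    fix i j assume ij: "i < dim_row (1\<^sub>m k)" "j < dim_col (1\<^sub>m k)"
    have "col X j = unit_vec l (f j)" using ij fl by (intro eq_vecI) (auto simp: X_def unit_vec_def)
    then have "(E * X) $$ (i, j) = E $$ (i, f j)" using ij E X fl by simp
    then show "(E * X) $$ (i, j) = 1\<^sub>m k $$ (i, j)"
      using ij fl[of j] pf(4)[of j] pf(5)[of j i] by auto
  qed (use E X in auto)
  have KX: "K * (X * P) \<in> carrier_mat k k" using K X PQ(2) by auto
  have "P * (K * (X * P)) = E * (X * P)"
    unfolding PQ(1) using PQ(2) K X by (intro assoc_mult_mat[symmetric, of _ k k _ l _ k]) auto
  also have "\<dots> = E * X * P" using E X PQ(2) by (intro assoc_mult_mat[symmetric, of _ k l _ k _ k]) auto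
  finally have PKX: "P * (K * (X * P)) = P" using EX PQ(2) by simp
  have "K * (X * P) = Q * P * (K * (X * P))" unfolding PQ(5) using KX by (rule left_mult_one_mat[symmetric])
  also have "\<dots> = Q * (P * (K * (X * P)))" using PQ(2,3) KX by (intro assoc_mult_mat[of _ k k _ k _ k])
  finally have "K * (X * P) = 1\<^sub>m k" using PKX PQ(5) by simp
  with X PQ show thesis by (intro that[of "X * P"]) auto
qed

lemma mult_mat_vec_surj_imp_right_inverse:
  fixes G :: "'a::field mat"
  assumes G: "G \<in> carrier_mat nr nc"
    and surj: "\<And>y. y \<in> carrier_vec nr \<Longrightarrow> \<exists>x \<in> carrier_vec nc. G *\<^sub>v x = y"
  obtains X where "X \<in> carrier_mat nc nr" "G * X = 1\<^sub>m nr"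
proof -
  have "\<forall>i. \<exists>x \<in> carrier_vec nc. G *\<^sub>v x = unit_vec nr i" using surj by simp
  then obtain x where x: "\<And>i. x i \<in> carrier_vec nc" "\<And>i. G *\<^sub>v x i = unit_vec nr i" by metis
  define X where "X = mat_of_cols nc (map x [0..<nr])"
  have X: "X \<in> carrier_mat nc nr" by (auto simp: X_def)
  have "col (G * X) i = col (1\<^sub>m nr) i" if "i < nr" for i
  proof -
    have "col (G * X) i = G *\<^sub>v col X i" using G X that by (rule col_mult2)
    also have "col X i = x i" using that x(1) by (simp add: X_def)
    finally show ?thesis using x(2) that by simp
  qed
  then have "G * X = 1\<^sub>m nr" using G X by (intro mat_col_eqI) auto
  with X that show thesis by blast
qed

text \<open>Besides the two-sided inverse, this identifies the result of \<open>mat_inverse\<close>, through which transfer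
  functions are defined.\<close>

lemma inverse_if_det_nonzero:
  fixes A :: "'a::field mat"
  assumes A: "A \<in> carrier_mat n n" and d: "det A \<noteq> 0"
  obtains B where "B \<in> carrier_mat n n" "A * B = 1\<^sub>m n" "B * A = 1\<^sub>m n" "mat_inverse A = Some B"
proof (cases "mat_inverse A")
  case None
  then show ?thesis using mat_inverse(1)[OF A None, of "()"] det_non_zero_imp_unit[OF A d, of "()"] by blast
next
  case (Some B)
  with mat_inverse(2)[OF A] that show ?thesis by auto
qed

section \<open>Minimal bases are row reduced\<close>

interpretation to_fract_hom: inj_idom_hom "to_fract :: 'a::idom \<Rightarrow> 'a fract"
  by unfold_locales auto

text \<open>Whether the rows form a basis is a question about the linear map given by the transposed matrix:
  distinctness of the list together with linear independence of its set of entries is injectivity, and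
  the span is the image. In this form a change of basis becomes composition with a bijection.\<close>

lemma polynomial_basis_rows_iff:
  fixes K :: "'a::field poly mat"
  assumes K: "K \<in> carrier_mat k l"
  shows "polynomial_basis l V (rows K) \<longleftrightarrow>
    (\<forall>v \<in> carrier_vec k. (rat_mat K)\<^sup>T *\<^sub>v v = 0\<^sub>v l \<longrightarrow> v = 0\<^sub>v k) \<and>
    V = {(rat_mat K)\<^sup>T *\<^sub>v v |v. v \<in> carrier_vec k}"
proof -
  interpret vec_space "TYPE('a poly fract)" l .
  let ?G = "(rat_mat K)\<^sup>T"
  have G: "?G \<in> carrier_mat l k" using K by simp
  have inj_rat: "inj rat_vec" by (intro injI) (rule to_fract_hom.vec_hom_inj)
  have rc: "map rat_vec (rows K) = cols ?G"
    using K by (intro nth_equalityI) auto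
  have dist: "distinct (rows K) \<longleftrightarrow> distinct (cols ?G)"
    unfolding rc[symmetric] distinct_map using inj_on_subset[OF inj_rat subset_UNIV] by blast
  have set_rc: "set (map rat_vec (rows K)) = set (cols ?G)" by (simp only: rc)
  have sub: "set (rows K) \<subseteq> carrier_vec l" using K rows_carrier by fastforce
  have sp: "rat_span l (rows K) = {?G *\<^sub>v v |v. v \<in> carrier_vec k}"
    unfolding rat_span_def set_rc using col_space_eq[OF G] G unfolding col_space_def by auto
  have ind: "distinct (rows K) \<and> lin_indpt (set (map rat_vec (rows K))) \<longleftrightarrow>
    (\<forall>v \<in> carrier_vec k. ?G *\<^sub>v v = 0\<^sub>v l \<longrightarrow> v = 0\<^sub>v k)"
  proof
    assume "distinct (rows K) \<and> lin_indpt (set (map rat_vec (rows K)))"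
    then have d: "distinct (cols ?G)" "lin_indpt (set (cols ?G))" using dist set_rc by auto
    then show "\<forall>v \<in> carrier_vec k. ?G *\<^sub>v v = 0\<^sub>v l \<longrightarrow> v = 0\<^sub>v k"
      using lin_depI[OF G _ _ _ d(1)] by blast
  next
    assume "\<forall>v \<in> carrier_vec k. ?G *\<^sub>v v = 0\<^sub>v l \<longrightarrow> v = 0\<^sub>v k"
    then have inj: "\<And>v. v \<in> carrier_vec k \<Longrightarrow> ?G *\<^sub>v v = 0\<^sub>v l \<Longrightarrow> v = 0\<^sub>v k" by blast
    have d: "distinct (cols ?G)" by (rule distinct_cols_if_inj[OF G inj])
    moreover have "lin_indpt (set (cols ?G))" using lin_depE[OF G _ d] inj by metis
    ultimately show "distinct (rows K) \<and> lin_indpt (set (map rat_vec (rows K)))"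
      using dist set_rc by simp
  qed
  show ?thesis unfolding polynomial_basis_def sp using sub ind by auto
qed

lemma vec_degree_le_iff: "vec_degree v \<le> d \<longleftrightarrow> (\<forall>j < dim_vec v. degree (v $ j) \<le> d)"
  by (auto simp: vec_degree_def vec_set_def)

lemma vec_degree_less_iff: "0 < d \<Longrightarrow> vec_degree v < d \<longleftrightarrow> (\<forall>j < dim_vec v. degree (v $ j) < d)"
  by (auto simp: vec_degree_def vec_set_def)

text \<open>When all the rows of \<open>K\<close> have degree \<open>d\<close>, this is the matrix of leading row coefficients.\<close>

definition lead_mat :: "nat \<Rightarrow> 'a::zero poly mat \<Rightarrow> 'a mat" where
  "lead_mat d K = map_mat (\<lambda>q. coeff q d) K"

text \<open>Suppose that the combination of the leading row coefficients with the coefficients \<open>c\<close> vanishes and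
  that \<open>c\<close> is nonzero at \<open>i\<close>. Replacing row \<open>i\<close> of \<open>K\<close> by the combination of all rows with these
  coefficients keeps the span, while the terms of degree \<open>d\<close> cancel in the new row: the sum of the row
  degrees drops, against minimality.\<close>

lemma minimal_basis_lead_independent:
  fixes K :: "'a::field poly mat"
  assumes K: "K \<in> carrier_mat k l"
    and min: "minimal_basis_mat K"
    and deg: "\<And>i. i < k \<Longrightarrow> row_degree K i = d" and d: "0 < d"
    and c: "c \<in> carrier_vec k" "(lead_mat d K)\<^sup>T *\<^sub>v c = 0\<^sub>v l"
  shows "c = 0\<^sub>v k"
proof (rule ccontr)
  assume "c \<noteq> 0\<^sub>v k"
  then obtain i where i: "i < k" "c $ i \<noteq> 0" using c(1) by (auto simp: vec_eq_iff)
  \<comment> \<open>The change of basis: row \<open>i\<close> becomes the combination with coefficients \<open>c\<close>; it is bijective as \<open>c $ i \<noteq> 0\<close>.\<close>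
  define P where "P = mat k k (\<lambda>(a, b). if a = i then [:c $ b:] else if a = b then 1 else 0)"
  have P: "P \<in> carrier_mat k k" by (simp add: P_def)
  define K' where "K' = P * K"
  have K': "K' \<in> carrier_mat k l" using P K by (simp add: K'_def)
  have bas: "polynomial_basis l (rat_span l (rows K)) (rows K)"
    using min K by (simp add: minimal_basis_mat_def minimal_basis_def)
  let ?G = "(rat_mat K)\<^sup>T"
  let ?H = "(rat_mat P)\<^sup>T"
  have G: "?G \<in> carrier_mat l k" and H: "?H \<in> carrier_mat k k" using K P by auto
  have G': "(rat_mat K')\<^sup>T *\<^sub>v v = ?G *\<^sub>v (?H *\<^sub>v v)" if v: "v \<in> carrier_vec k" for v
  proof -
    have "(rat_mat K')\<^sup>T = ?G * ?H"
      unfolding K'_def to_fract_hom.mat_hom_mult[OF P K]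
      using K P by (intro transpose_mult[of _ k k _ l]) auto
    then show ?thesis using G H v by (simp add: assoc_mult_mat_vec[of _ l k _ k])
  qed
  have Hv: "(?H *\<^sub>v v) $ b = (if b = i then 0 else v $ b) + rat_const (c $ b) * v $ i"
    if v: "v \<in> carrier_vec k" and b: "b < k" for v b
  proof -
    have "(?H *\<^sub>v v) $ b = (\<Sum>a<k. to_fract (P $$ (a, b)) * v $ a)"
      using v b P by (auto simp: scalar_prod_def atLeast0LessThan)
    also have "\<dots> = rat_const (c $ b) * v $ i + (\<Sum>a\<in>{..<k} - {i}. to_fract (P $$ (a, b)) * v $ a)"
      using i b by (subst sum.remove[of _ i]) (auto simp: P_def rat_const_def)
    also have "(\<Sum>a\<in>{..<k} - {i}. to_fract (P $$ (a, b)) * v $ a)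
      = (\<Sum>a\<in>{..<k} - {i}. if a = b then v $ b else 0)"
      using b by (intro sum.cong) (auto simp: P_def)
    also have "\<dots> = (if b = i then 0 else v $ b)" using b by (simp add: sum.delta)
    finally show ?thesis by (simp add: add.commute)
  qed
  have Hinj: "v = 0\<^sub>v k" if v: "v \<in> carrier_vec k" and z: "?H *\<^sub>v v = 0\<^sub>v k" for v
  proof -
    have vi: "v $ i = 0" using Hv[OF v i(1)] z i by simp
    have "v $ b = 0" if b: "b < k" for b using Hv[OF v b] z b vi by (auto split: if_splits)
    then show ?thesis using v by (intro eq_vecI) auto
  qed
  have Hsurj: "\<exists>v \<in> carrier_vec k. ?H *\<^sub>v v = w" if w: "w \<in> carrier_vec k" for w
  proof
    let ?t = "w $ i / rat_const (c $ i)"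
    let ?v = "vec k (\<lambda>b. if b = i then ?t else w $ b - rat_const (c $ b) * ?t)"
    show v: "?v \<in> carrier_vec k" by simp
    show "?H *\<^sub>v ?v = w"
      using w H i(1) by (intro eq_vecI) (simp_all add: Hv[OF v] i del: index_mult_mat_vec)
  qed
  have basK: "\<forall>v \<in> carrier_vec k. ?G *\<^sub>v v = 0\<^sub>v l \<longrightarrow> v = 0\<^sub>v k"
    using bas[unfolded polynomial_basis_rows_iff[OF K]] by blast
  have "polynomial_basis l (rat_span l (rows K)) (rows K')"
    unfolding polynomial_basis_rows_iff[OF K']
  proof (intro conjI ballI impI)
    fix v assume "v \<in> carrier_vec k" "(rat_mat K')\<^sup>T *\<^sub>v v = 0\<^sub>v l"
    then have v: "v \<in> carrier_vec k" "?G *\<^sub>v (?H *\<^sub>v v) = 0\<^sub>v l" using G' by auto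
    have "?H *\<^sub>v v \<in> carrier_vec k" using H v(1) by (rule mult_mat_vec_carrier)
    with v(2) basK have "?H *\<^sub>v v = 0\<^sub>v k" by blast
    then show "v = 0\<^sub>v k" by (rule Hinj[OF v(1)])
  next
    have "{?G *\<^sub>v v |v. v \<in> carrier_vec k} = {?G *\<^sub>v (?H *\<^sub>v v) |v. v \<in> carrier_vec k}"
    proof (intro equalityI subsetI)
      fix y assume "y \<in> {?G *\<^sub>v v |v. v \<in> carrier_vec k}"
      then obtain w where w: "w \<in> carrier_vec k" "y = ?G *\<^sub>v w" by blast
      from Hsurj[OF w(1)] obtain v where v: "v \<in> carrier_vec k" "?H *\<^sub>v v = w" ..
      then show "y \<in> {?G *\<^sub>v (?H *\<^sub>v v) |v. v \<in> carrier_vec k}" using w(2) by blast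
    next
      fix y assume "y \<in> {?G *\<^sub>v (?H *\<^sub>v v) |v. v \<in> carrier_vec k}"
      then obtain v where v: "v \<in> carrier_vec k" "y = ?G *\<^sub>v (?H *\<^sub>v v)" by blast
      have "?H *\<^sub>v v \<in> carrier_vec k" using H v(1) by (rule mult_mat_vec_carrier)
      then show "y \<in> {?G *\<^sub>v v |v. v \<in> carrier_vec k}" using v(2) by blast
    qed
    also have "\<dots> = {(rat_mat K')\<^sup>T *\<^sub>v v |v. v \<in> carrier_vec k}"
      by (intro Collect_cong) (metis G')
    finally show "rat_span l (rows K) = {(rat_mat K')\<^sup>T *\<^sub>v v |v. v \<in> carrier_vec k}"
      using bas[unfolded polynomial_basis_rows_iff[OF K]] by simp
  qed
  then have le: "sum_list (map vec_degree (rows K)) \<le> sum_list (map vec_degree (rows K'))"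
    using min K by (simp add: minimal_basis_mat_def minimal_basis_def)
  have sum: "sum_list (map vec_degree (rows L)) = (\<Sum>a<k. row_degree L a)"
    if "L \<in> carrier_mat k l" for L :: "'a poly mat"
    using that by (simp add: rows_def row_degree_def interv_sum_list_conv_sum_set_nat
        atLeast0LessThan comp_def)
  have dK: "degree (K $$ (a, j)) \<le> d" if "a < k" "j < l" for a j
    using deg[OF that(1)] that K vec_degree_le_iff[of "row K a" d] by (auto simp: row_degree_def)
  have K'el: "K' $$ (a, j) = (\<Sum>b<k. P $$ (a, b) * K $$ (b, j))" if "a < k" "j < l" for a j
    using that P K by (auto simp: K'_def scalar_prod_def atLeast0LessThan)
  have "degree (K' $$ (i, j)) < d" if j: "j < l" for j
  proof -
    have e: "K' $$ (i, j) = (\<Sum>b<k. Polynomial.smult (c $ b) (K $$ (b, j)))"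
      using K'el[OF i(1) j] i by (simp add: P_def)
    have "degree (K' $$ (i, j)) \<le> d"
      unfolding e using dK j by (intro degree_sum_le) (auto intro: order_trans[OF degree_smult_le])
    moreover have "coeff (K' $$ (i, j)) d = ((lead_mat d K)\<^sup>T *\<^sub>v c) $ j"
      unfolding e using K c(1) j
      by (auto simp: coeff_sum lead_mat_def scalar_prod_def atLeast0LessThan mult.commute)
    then have "coeff (K' $$ (i, j)) d = 0" using c j by simp
    ultimately show ?thesis using d eq_zero_or_degree_less by fastforce
  qed
  then have less: "row_degree K' i < d"
    unfolding row_degree_def vec_degree_less_iff[OF d] using K' i by simp
  have "row K' a = row K a" if a: "a < k" "a \<noteq> i" for a
  proof (rule eq_vecI)
    fix j assume "j < dim_vec (row K a)"
    then have j: "j < l" using K by simp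
    have "K' $$ (a, j) = (\<Sum>b<k. if b = a then K $$ (b, j) else 0)"
      unfolding K'el[OF a(1) j] using a by (intro sum.cong) (auto simp: P_def)
    then show "row K' a $ j = row K a $ j" using a j K K' by (simp add: sum.delta)
  qed (use K K' in simp)
  then have "row_degree K' a \<le> d" if "a < k" for a
    using that less deg by (cases "a = i") (auto simp: row_degree_def)
  with less i have "(\<Sum>a<k. row_degree K' a) < (\<Sum>a<k. d)"
    by (intro sum_strict_mono_ex1) auto
  also have "(\<Sum>a<k. d) = (\<Sum>a<k. row_degree K a)" using deg by simp
  finally show False using le sum[OF K] sum[OF K'] by simp
qed

section \<open>Reversals and their values at zero\<close>

lemma map_poly_rat_const_1: "map_poly rat_const 1 = 1"
  by (simp add: rat_const_def poly_eq_iff coeff_map_poly flip: one_pCons)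

lemma recip_subst_to_fract:
  "recip_subst (to_fract p) = poly (map_poly rat_const p) (inverse rat_X)"
  using recip_subst_Fract[of 1 p] by (simp add: to_fract_def map_poly_rat_const_1)

lemma recip_subst_Fract':
  "q \<noteq> 0 \<Longrightarrow> recip_subst (Fract p q) = recip_subst (to_fract p) / recip_subst (to_fract q)"
  by (simp add: recip_subst_to_fract recip_subst_Fract)

lemma recip_subst_to_fract_add:
  "recip_subst (to_fract (p + q)) = recip_subst (to_fract p) + recip_subst (to_fract q)"
proof -
  have "map_poly rat_const (p + q) = map_poly rat_const p + map_poly rat_const q"
    by (simp add: poly_eq_iff coeff_map_poly)
  then show ?thesis by (simp add: recip_subst_to_fract del: to_fract_add)
qed

lemma recip_subst_to_fract_mult:
  "recip_subst (to_fract (p * q)) = recip_subst (to_fract p) * recip_subst (to_fract q)"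
  by (simp add: recip_subst_to_fract poly_rat_const_mult del: to_fract_mult)

lemma recip_subst_to_fract_eq_0: "recip_subst (to_fract p) = 0 \<longleftrightarrow> p = 0"
  using poly_rat_const_inverse_X_nonzero[of p] by (auto simp: recip_subst_to_fract)

text \<open>Substituting the inverse of the variable is an embedding of the field of rational functions, so it
  commutes with matrix products, inverses and determinants.\<close>

interpretation recip_subst_hom: inj_idom_hom "recip_subst :: 'a::field poly fract \<Rightarrow> _"
proof
  have one: "recip_subst (1 :: 'a poly fract) = 1"
    using recip_subst_to_fract[of 1] by (simp add: map_poly_rat_const_1)
  have zero: "recip_subst (0 :: 'a poly fract) = 0"
    using recip_subst_to_fract[of 0] by simp
  show "recip_subst (0 :: 'a poly fract) = 0" "recip_subst (1 :: 'a poly fract) = 1"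
    by (fact zero one)+
  fix x y :: "'a poly fract"
  obtain p q where x: "x = Fract p q" "q \<noteq> 0" by (cases x) auto
  obtain r s where y: "y = Fract r s" "s \<noteq> 0" by (cases y) auto
  show "recip_subst (x + y) = recip_subst x + recip_subst y"
    using x y by (simp add: recip_subst_Fract' recip_subst_to_fract_add recip_subst_to_fract_mult
        recip_subst_to_fract_eq_0 add_frac_eq del: to_fract_add to_fract_mult)
  show "recip_subst (x * y) = recip_subst x * recip_subst y"
    using x y by (simp add: recip_subst_Fract' recip_subst_to_fract_mult del: to_fract_mult)
  show "recip_subst x = 0 \<Longrightarrow> x = 0"
    using x by (auto simp: recip_subst_Fract' recip_subst_to_fract_eq_0 fract_collapse)
qed

lemma rev_mat_dim [simp]: "dim_row (rev_mat g G) = dim_row G" "dim_col (rev_mat g G) = dim_col G"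
  by (simp_all add: rev_mat_def)

lemma rev_mat_carrier: "G \<in> carrier_mat nr nc \<Longrightarrow> rev_mat g G \<in> carrier_mat nr nc"
  by (intro carrier_matI) auto

lemma rev_mat_mult:
  assumes "G \<in> carrier_mat nr n" "H \<in> carrier_mat n nc"
  shows "rev_mat (g + h) (G * H) = rev_mat g G * rev_mat h H"
proof -
  have "rev_mat g G * rev_mat h H
    = (rat_X powi h) \<cdot>\<^sub>m ((rat_X powi g) \<cdot>\<^sub>m (map_mat recip_subst G * map_mat recip_subst H))"
    unfolding rev_mat_def using assms
    by (simp add: mult_smult_assoc_mat[of _ nr n _ nc] mult_smult_distrib[of _ nr n _ nc])
  also have "\<dots> = rev_mat (g + h) (G * H)"
    unfolding rev_mat_def recip_subst_hom.mat_hom_mult[OF assms]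
    by (intro eq_matI) (simp_all add: power_int_add ac_simps)
  finally show ?thesis ..
qed

lemma rev_mat_add:
  assumes "G \<in> carrier_mat nr nc" "H \<in> carrier_mat nr nc"
  shows "rev_mat g (G + H) = rev_mat g G + rev_mat g H"
  using assms by (intro eq_matI) (simp_all add: rev_mat_def recip_subst_hom.hom_add distrib_left)

lemma rev_mat_0_one: "rev_mat 0 (1\<^sub>m n) = 1\<^sub>m n"
  by (intro eq_matI) (simp_all add: rev_mat_def)

lemma det_rev_mat_eq_0_iff: "det (rev_mat g G) = 0 \<longleftrightarrow> det G = 0"
  by (simp add: rev_mat_def recip_subst_hom.hom_det)

text \<open>For \<open>g \<ge> degree p\<close> this is the polynomial $\lambda^g p(1/\lambda)$. Its value at zero is the
  coefficient of degree \<open>g\<close>, so that values of reversals at zero are leading coefficients.\<close>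

definition rev_poly :: "nat \<Rightarrow> 'a::field poly \<Rightarrow> 'a poly" where
  "rev_poly g p = monom 1 (g - degree p) * reflect_poly p"

lemma rev_poly_to_fract:
  assumes "degree p \<le> g"
  shows "to_fract (rev_poly g p) = rat_X powi int g * recip_subst (to_fract p)"
proof -
  have "to_fract (monom 1 k :: 'a poly) = rat_X ^ k" for k
    by (simp add: rat_X_def to_fract_hom.hom_power[symmetric] monom_altdef)
  then have "to_fract (rev_poly g p) = rat_X ^ (g - degree p) * (rat_X ^ degree p * recip_subst (to_fract p))"
    by (simp add: rev_poly_def recip_subst_to_fract poly_rat_const_inverse_X)
  also have "\<dots> = rat_X ^ g * recip_subst (to_fract p)"
    using assms by (simp add: mult.assoc[symmetric] power_add[symmetric])
  finally show ?thesis by simp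
qed

lemma poly_rev_poly_0:
  assumes "degree p \<le> g"
  shows "poly (rev_poly g p) 0 = coeff p g"
proof -
  have "poly (rev_poly g p) 0 = 0 ^ (g - degree p) * lead_coeff p"
    unfolding rev_poly_def poly_mult by (simp add: poly_monom)
  also have "\<dots> = coeff p g"
  proof (cases "degree p = g")
    case False
    with assms have "degree p < g" by simp
    then show ?thesis by (simp add: coeff_eq_0)
  qed simp
  finally show ?thesis .
qed

lemma rev_poly_0 [simp]: "rev_poly g 0 = 0"
  by (simp add: rev_poly_def)

definition deg_bounded :: "nat \<Rightarrow> 'a::zero poly mat \<Rightarrow> bool" where
  "deg_bounded g G \<longleftrightarrow> (\<forall>i < dim_row G. \<forall>j < dim_col G. degree (G $$ (i, j)) \<le> g)"

abbreviation rev_poly_mat :: "nat \<Rightarrow> 'a::field poly mat \<Rightarrow> 'a poly mat" where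
  "rev_poly_mat g \<equiv> map_mat (rev_poly g)"

abbreviation at0 :: "'a::field poly mat \<Rightarrow> 'a mat" where
  "at0 \<equiv> map_mat (\<lambda>p. poly p 0)"

interpretation poly_0_hom: comm_ring_hom "\<lambda>p :: 'a::comm_ring_1 poly. poly p 0"
  by unfold_locales auto

lemma rat_rev_poly_mat:
  "deg_bounded g G \<Longrightarrow> rat_mat (rev_poly_mat g G) = rev_mat (int g) (rat_mat G)"
  by (intro eq_matI) (auto simp: rev_mat_def rev_poly_to_fract deg_bounded_def)

lemma at0_rev_poly_mat: "deg_bounded g G \<Longrightarrow> at0 (rev_poly_mat g G) = lead_mat g G"
  by (intro eq_matI) (auto simp: lead_mat_def poly_rev_poly_0 deg_bounded_def)

lemma rat_eval_rat_mat: "map_mat (rat_eval 0) (rat_mat G) = at0 G"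
  by (intro eq_matI) (auto simp: rat_eval_to_fract)

lemma deg_bounded_mult:
  assumes "M \<in> carrier_mat nr n" "N \<in> carrier_mat n nc"
    and "deg_bounded g M" "deg_bounded h N"
  shows "deg_bounded (g + h) (M * N)"
  unfolding deg_bounded_def
proof (intro allI impI)
  fix i j assume "i < dim_row (M * N)" "j < dim_col (M * N)"
  then have ij: "i < nr" "j < nc" using assms by auto
  have "(M * N) $$ (i, j) = (\<Sum>k<n. M $$ (i, k) * N $$ (k, j))"
    using ij assms(1,2) by (auto simp: scalar_prod_def atLeast0LessThan)
  also have "degree \<dots> \<le> g + h"
    using assms ij by (intro degree_sum_le order_trans[OF degree_mult_le] add_mono)
      (auto simp: deg_bounded_def)
  finally show "degree ((M * N) $$ (i, j)) \<le> g + h" .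
qed

lemma rev_poly_mat_mult:
  assumes "M \<in> carrier_mat nr n" "N \<in> carrier_mat n nc"
    and "deg_bounded g M" "deg_bounded h N"
  shows "rev_poly_mat (g + h) (M * N) = rev_poly_mat g M * rev_poly_mat h N"
proof (rule to_fract_hom.mat_hom_inj)
  show "rat_mat (rev_poly_mat (g + h) (M * N)) = rat_mat (rev_poly_mat g M * rev_poly_mat h N)"
    using assms
    by (simp add: rat_rev_poly_mat deg_bounded_mult[OF assms] to_fract_hom.mat_hom_mult[of _ nr n _ nc]
        rev_mat_mult[of _ nr n _ nc])
qed

text \<open>This carries regularity of \<open>A\<close> to its reversal, and regularity of the reversed state matrix back to
  the state matrix of the pencil.\<close>

lemma det_rev_poly_mat_eq_0_iff:
  assumes "deg_bounded g G"
  shows "det (rev_poly_mat g G) = 0 \<longleftrightarrow> det G = 0"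
proof -
  have "det (rat_mat (rev_poly_mat g G)) = 0 \<longleftrightarrow> det (rat_mat G) = 0"
    unfolding rat_rev_poly_mat[OF assms] by (rule det_rev_mat_eq_0_iff)
  then show ?thesis by (simp add: to_fract_hom.hom_det)
qed

text \<open>The grade of the inverse is the negative of the grade of the matrix, so the grades of \<open>C\<close>, \<open>Ai\<close> and \<open>B\<close>
  have to add up to that of \<open>D\<close>. With grade \<open>\<rho>\<^sub>A + 1\<close> for \<open>A\<close> and \<open>C\<close> and grade \<open>\<rho>\<^sub>D + 1\<close> for \<open>B\<close> and \<open>D\<close>,
  the sum is the grade \<open>\<rho>\<^sub>D + 1\<close> of the linearization.\<close>

lemma rev_mat_transfer_function:
  assumes A: "A \<in> carrier_mat n n" and B: "B \<in> carrier_mat n m" and C: "C \<in> carrier_mat p n"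
    and D: "D \<in> carrier_mat p m" and Ai: "Ai \<in> carrier_mat n n"
    and g: "g = c - a + b"
  shows "rev_mat g (D + C * Ai * B) = rev_mat g D + rev_mat c C * rev_mat (- a) Ai * rev_mat b B"
proof -
  have CAi: "C * Ai \<in> carrier_mat p n" using C Ai by (rule mult_carrier_mat)
  have CAiB: "C * Ai * B \<in> carrier_mat p m" using CAi B by (rule mult_carrier_mat)
  have "rev_mat ((c + (- a)) + b) (C * Ai * B) = rev_mat c C * rev_mat (- a) Ai * rev_mat b B"
    unfolding rev_mat_mult[OF CAi B] rev_mat_mult[OF C Ai] ..
  then show ?thesis unfolding rev_mat_add[OF D CAiB] g by simp
qed

lemma rev_mat_inverse:
  assumes "A \<in> carrier_mat n n" "B \<in> carrier_mat n n" "A * B = 1\<^sub>m n"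
  shows "rev_mat a A * rev_mat (- a) B = 1\<^sub>m n"
  using rev_mat_mult[OF assms(1,2), of a "- a"] assms(3) by (simp add: rev_mat_0_one)

lemma is_eigenvalue_rat_mat_iff:
  "is_eigenvalue (rat_mat G) 0 \<longleftrightarrow> mat_rank (at0 G) < mat_rank (rat_mat G)"
  by (simp add: is_eigenvalue_def rat_eval_rat_mat)

section \<open>Block matrices\<close>

lemma append_rows_dim [simp]:
  "dim_row (A @\<^sub>r B) = dim_row A + dim_row B" "dim_col (A @\<^sub>r B) = dim_col A"
  by (simp_all add: append_rows_def)

lemma append_cols_dim [simp]:
  "dim_row (append_cols A B) = dim_row A" "dim_col (append_cols A B) = dim_col A + dim_col B"
  by (simp_all add: append_cols_def)

lemma append_cols_carrier:
  "A \<in> carrier_mat nr c1 \<Longrightarrow> B \<in> carrier_mat nr c2 \<Longrightarrow> append_cols A B \<in> carrier_mat nr (c1 + c2)"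
  by (intro carrier_matI) auto

lemma map_mat_append_rows:
  "A \<in> carrier_mat r1 nc \<Longrightarrow> B \<in> carrier_mat r2 nc \<Longrightarrow> map_mat f (A @\<^sub>r B) = map_mat f A @\<^sub>r map_mat f B"
  by (intro eq_matI) (auto simp: append_rows_def)

lemma map_mat_append_cols:
  "A \<in> carrier_mat nr c1 \<Longrightarrow> B \<in> carrier_mat nr c2 \<Longrightarrow>
    map_mat f (append_cols A B) = append_cols (map_mat f A) (map_mat f B)"
  by (intro eq_matI) (auto simp: append_cols_def)

lemma append_rows_mult:
  fixes A B C :: "'a::comm_ring_1 mat"
  assumes A: "A \<in> carrier_mat r1 n" and B: "B \<in> carrier_mat r2 n" and C: "C \<in> carrier_mat n nc"
  shows "(A @\<^sub>r B) * C = (A * C) @\<^sub>r (B * C)"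
proof (intro eq_matI)
  fix i j assume "i < dim_row ((A * C) @\<^sub>r (B * C))" "j < dim_col ((A * C) @\<^sub>r (B * C))"
  then have ij: "i < r1 + r2" "j < nc" using A B C by auto
  have "row (A @\<^sub>r B) i = (if i < r1 then row A i else row B (i - r1))"
    using A B ij by (intro eq_vecI) (auto simp: append_rows_def)
  then show "((A @\<^sub>r B) * C) $$ (i, j) = ((A * C) @\<^sub>r (B * C)) $$ (i, j)"
    using A B C ij by (auto simp: append_rows_def)
qed auto

lemma mult_append_cols:
  fixes M A B :: "'a::comm_ring_1 mat"
  assumes M: "M \<in> carrier_mat nr n" and A: "A \<in> carrier_mat n c1" and B: "B \<in> carrier_mat n c2"
  shows "M * append_cols A B = append_cols (M * A) (M * B)"
proof (intro eq_matI)
  fix i j assume "i < dim_row (append_cols (M * A) (M * B))" "j < dim_col (append_cols (M * A) (M * B))"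
  then have ij: "i < nr" "j < c1 + c2" using A B M by auto
  have "col (append_cols A B) j = (if j < c1 then col A j else col B (j - c1))"
    using A B ij by (intro eq_vecI) (auto simp: append_cols_def)
  then show "(M * append_cols A B) $$ (i, j) = append_cols (M * A) (M * B) $$ (i, j)"
    using A B M ij by (auto simp: append_cols_def)
qed (use M A B in auto)

lemma append_rows_mult_append_cols:
  fixes A B C D :: "'a::comm_ring_1 mat"
  assumes "A \<in> carrier_mat r1 n" "B \<in> carrier_mat r2 n" "C \<in> carrier_mat n c1" "D \<in> carrier_mat n c2"
  shows "(A @\<^sub>r B) * append_cols C D = four_block_mat (A * C) (A * D) (B * C) (B * D)"
proof -
  have "(A @\<^sub>r B) * append_cols C D = append_cols (A * C) (A * D) @\<^sub>r append_cols (B * C) (B * D)"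
    using assms by (simp add: append_rows_mult[OF assms(1,2) append_cols_carrier[OF assms(3,4)]]
        mult_append_cols[of _ _ n])
  also have "\<dots> = four_block_mat (A * C) (A * D) (B * C) (B * D)"
    using assms by (intro eq_matI) (auto simp: append_rows_def append_cols_def)
  finally show ?thesis .
qed

lemma append_cols_mult_append_rows:
  fixes A B C D :: "'a::comm_ring_1 mat"
  assumes A: "A \<in> carrier_mat nr c1" and B: "B \<in> carrier_mat nr c2"
    and C: "C \<in> carrier_mat c1 nc" and D: "D \<in> carrier_mat c2 nc"
  shows "append_cols A B * (C @\<^sub>r D) = A * C + B * D"
proof (intro eq_matI)
  fix i j assume "i < dim_row (A * C + B * D)" "j < dim_col (A * C + B * D)"
  then have ij: "i < nr" "j < nc" using A B C D by auto
  have "row (append_cols A B) i = row A i @\<^sub>v row B i"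
    using A B ij by (intro eq_vecI) (auto simp: append_cols_def)
  moreover have "col (C @\<^sub>r D) j = col C j @\<^sub>v col D j"
    using C D ij by (intro eq_vecI) (auto simp: append_rows_def)
  ultimately have "(append_cols A B * (C @\<^sub>r D)) $$ (i, j) = (row A i @\<^sub>v row B i) \<bullet> (col C j @\<^sub>v col D j)"
    using A B C D ij by simp
  also have "\<dots> = row A i \<bullet> col C j + row B i \<bullet> col D j"
    using A B C D by (intro scalar_prod_append[of _ c1 _ c2]) auto
  finally show "(append_cols A B * (C @\<^sub>r D)) $$ (i, j) = (A * C + B * D) $$ (i, j)"
    using A B C D ij by simp
qed (use A B C D in auto)

lemma append_cols_mult_append_vec:
  fixes A B :: "'a::comm_ring_1 mat"
  assumes A: "A \<in> carrier_mat nr c1" and B: "B \<in> carrier_mat nr c2"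
    and v: "v \<in> carrier_vec c1" and w: "w \<in> carrier_vec c2"
  shows "append_cols A B *\<^sub>v (v @\<^sub>v w) = A *\<^sub>v v + B *\<^sub>v w"
proof (rule eq_vecI)
  fix i assume "i < dim_vec (A *\<^sub>v v + B *\<^sub>v w)"
  then have i: "i < nr" using B by simp
  have "row (append_cols A B) i = row A i @\<^sub>v row B i"
    using A B i by (intro eq_vecI) (auto simp: append_cols_def)
  then have "(append_cols A B *\<^sub>v (v @\<^sub>v w)) $ i = (row A i @\<^sub>v row B i) \<bullet> (v @\<^sub>v w)"
    using A i by simp
  also have "\<dots> = row A i \<bullet> v + row B i \<bullet> w"
    using A B v w by (intro scalar_prod_append[of _ c1 _ c2]) auto
  finally show "(append_cols A B *\<^sub>v (v @\<^sub>v w)) $ i = (A *\<^sub>v v + B *\<^sub>v w) $ i"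
    using A B i by simp
qed (use A B in auto)

lemma zero_mat_mult_vec: "w \<in> carrier_vec l \<Longrightarrow> 0\<^sub>m s l *\<^sub>v w = 0\<^sub>v s"
  by (intro eq_vecI) auto

lemma append_vec_cases:
  assumes "v \<in> carrier_vec (n + s)"
  obtains a b where "a \<in> carrier_vec n" "b \<in> carrier_vec s" "v = a @\<^sub>v b"
proof
  show "vec_first v n \<in> carrier_vec n" "vec_last v s \<in> carrier_vec s" by auto
  show "v = vec_first v n @\<^sub>v vec_last v s" using assms by simp
qed

lemma append_vec_eq_0_iff:
  fixes a :: "'a::comm_ring_1 vec"
  assumes "a \<in> carrier_vec n" "b \<in> carrier_vec s"
  shows "a @\<^sub>v b = 0\<^sub>v (n + s) \<longleftrightarrow> a = 0\<^sub>v n \<and> b = 0\<^sub>v s"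
proof -
  have "0\<^sub>v (n + s) = 0\<^sub>v n @\<^sub>v (0\<^sub>v s :: 'a vec)" by (intro eq_vecI) auto
  then show ?thesis using append_vec_eq[OF assms(1) zero_carrier_vec] by simp
qed

lemma map_mat_zero_mat: "f 0 = 0 \<Longrightarrow> map_mat f (0\<^sub>m r c) = 0\<^sub>m r c"
  by (intro eq_matI) auto

section \<open>Dual bases at infinity\<close>

lemma linear_mat_iff: "linear_mat G \<longleftrightarrow> deg_bounded 1 G"
  unfolding linear_mat_def deg_bounded_def elements_mat_def by auto

lemma mat_degree_le_iff: "mat_degree G \<le> g \<longleftrightarrow> deg_bounded g G"
proof -
  have "mat_degree G \<le> g \<longleftrightarrow> (\<forall>p \<in> elements_mat G. degree p \<le> g)"
    by (auto simp: mat_degree_def elements_mat_def)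
  also have "\<dots> \<longleftrightarrow> deg_bounded g G"
    unfolding deg_bounded_def elements_mat_def by auto
  finally show ?thesis .
qed

lemma deg_bounded_iff_row_degree: "deg_bounded g G \<longleftrightarrow> (\<forall>i < dim_row G. row_degree G i \<le> g)"
  unfolding deg_bounded_def row_degree_def vec_degree_le_iff by simp

lemma deg_bounded_append_rows:
  "dim_col A = dim_col B \<Longrightarrow> deg_bounded g A \<Longrightarrow> deg_bounded g B \<Longrightarrow> deg_bounded g (A @\<^sub>r B)"
  unfolding deg_bounded_def append_rows_def by simp

lemma deg_bounded_append_rowsD:
  assumes "deg_bounded g (A @\<^sub>r B)"
  shows "deg_bounded g A"
  unfolding deg_bounded_def
proof (intro allI impI)
  fix i j assume ij: "i < dim_row A" "j < dim_col A"
  then have "degree ((A @\<^sub>r B) $$ (i, j)) \<le> g" using assms unfolding deg_bounded_def by simp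
  then show "degree (A $$ (i, j)) \<le> g" using ij by (simp add: append_rows_def)
qed

lemma deg_bounded_zero_mat: "deg_bounded g (0\<^sub>m r c)"
  by (simp add: deg_bounded_def)

lemma deg_bounded_uminus: "deg_bounded g (- G) \<longleftrightarrow> deg_bounded g (G :: 'a::ring_1 poly mat)"
  by (auto simp: deg_bounded_def)

lemma deg_bounded_four_block:
  assumes "A \<in> carrier_mat r1 c1" "B \<in> carrier_mat r1 c2" "C \<in> carrier_mat r2 c1" "D \<in> carrier_mat r2 c2"
    and "deg_bounded g A" "deg_bounded g B" "deg_bounded g C" "deg_bounded g D"
  shows "deg_bounded g (four_block_mat A B C D)"
  using assms unfolding deg_bounded_def by simp

text \<open>Everything that is used about the minimal bases: their reversals are still orthogonal, and both have
  full row rank at zero. The reversed \<open>N\<close> appears transposed because the blocks of the pencil act on it from the left.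
  Positivity of \<open>n\<close> and of \<open>\<rho>\<close> comes from the requirement that a minimal basis has fewer rows than columns.\<close>

lemma dual_minimal_bases_at_infinity:
  fixes K N :: "'a::field poly mat"
  assumes K: "K \<in> carrier_mat (\<rho> * n) ((\<rho> + 1) * n)"
    and rowK: "\<forall>i < dim_row K. row_degree K i = 1"
    and dual: "dual_minimal_bases K N" and eq: "equal_row_degrees N" and \<rho>: "\<rho> = mat_degree N"
  shows "0 < n" "0 < \<rho>" "N \<in> carrier_mat n (n + \<rho> * n)"
    and "deg_bounded 1 K" "deg_bounded \<rho> N\<^sup>T"
    and "rev_poly_mat 1 K * rev_poly_mat \<rho> N\<^sup>T = 0\<^sub>m (\<rho> * n) n"
    and "\<And>v. v \<in> carrier_vec (\<rho> * n) \<Longrightarrow> (at0 (rev_poly_mat 1 K))\<^sup>T *\<^sub>v v = 0\<^sub>v (n + \<rho> * n) \<Longrightarrow> v = 0\<^sub>v (\<rho> * n)"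
    and "\<And>w. w \<in> carrier_vec n \<Longrightarrow> at0 (rev_poly_mat \<rho> N\<^sup>T) *\<^sub>v w = 0\<^sub>v (n + \<rho> * n) \<Longrightarrow> w = 0\<^sub>v n"
proof -
  have K': "K \<in> carrier_mat (\<rho> * n) (n + \<rho> * n)" using K by (simp add: algebra_simps)
  have minK: "minimal_basis_mat K" and minN: "minimal_basis_mat N"
    and dN: "dim_col N = dim_col K" "dim_row K + dim_row N = dim_col K"
    and KN: "K * N\<^sup>T = 0\<^sub>m (dim_row K) (dim_row N)"
    using dual unfolding dual_minimal_bases_def by blast+
  show N: "N \<in> carrier_mat n (n + \<rho> * n)" using dN K' by (intro carrier_matI) auto
  show n0: "0 < n" using minK K' by (simp add: minimal_basis_mat_def)
  show \<rho>0: "0 < \<rho>" using minN N by (cases "\<rho> = 0") (auto simp: minimal_basis_mat_def)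
  show dK: "deg_bounded 1 K"
    unfolding deg_bounded_iff_row_degree using rowK by simp
  obtain d where d: "\<And>i. i < n \<Longrightarrow> row_degree N i = d"
    using eq N by (auto simp: equal_row_degrees_def)
  have "deg_bounded g N \<longleftrightarrow> (\<forall>i < n. row_degree N i \<le> g)" for g
    using N by (simp add: deg_bounded_iff_row_degree)
  then have "deg_bounded g N \<longleftrightarrow> d \<le> g" for g using d n0 by auto
  then have dle: "\<rho> \<le> g \<longleftrightarrow> d \<le> g" for g unfolding \<rho> mat_degree_le_iff .
  then have d\<rho>: "d = \<rho>" by (metis le_antisym order_refl)
  have "deg_bounded \<rho> N" using mat_degree_le_iff[of N \<rho>] \<rho> by simp
  then show dNT: "deg_bounded \<rho> N\<^sup>T" by (auto simp: deg_bounded_def)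
  have NT: "N\<^sup>T \<in> carrier_mat (n + \<rho> * n) n" using N by simp
  show "rev_poly_mat 1 K * rev_poly_mat \<rho> N\<^sup>T = 0\<^sub>m (\<rho> * n) n"
    unfolding rev_poly_mat_mult[OF K' NT dK dNT, symmetric] KN using K' N by (intro eq_matI) auto
  show "v = 0\<^sub>v (\<rho> * n)" if "v \<in> carrier_vec (\<rho> * n)"
    "(at0 (rev_poly_mat 1 K))\<^sup>T *\<^sub>v v = 0\<^sub>v (n + \<rho> * n)" for v
    using minimal_basis_lead_independent[OF K' minK, of 1 v] that rowK K'
    unfolding at0_rev_poly_mat[OF dK] by simp
  have e: "lead_mat \<rho> N\<^sup>T = (lead_mat \<rho> N)\<^sup>T" by (simp add: lead_mat_def map_mat_transpose)
  show "w = 0\<^sub>v n" if "w \<in> carrier_vec n"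
    "at0 (rev_poly_mat \<rho> N\<^sup>T) *\<^sub>v w = 0\<^sub>v (n + \<rho> * n)" for w
    using minimal_basis_lead_independent[OF N minN, of \<rho> w] that d d\<rho> \<rho>0
    unfolding at0_rev_poly_mat[OF dNT] e by simp
qed

text \<open>Applying \<open>K\<close> to \<open>N a + X b\<close> returns \<open>b\<close>. So \<open>N a + X b = 0\<close> forces \<open>b = 0\<close> and then \<open>a = 0\<close>, which makes
  \<open>[N X]\<close> invertible; and when \<open>K\<close> kills \<open>N a + X b\<close>, only \<open>N a\<close> is left.\<close>

lemma dual_completion_field:
  fixes K N :: "'a::field mat"
  assumes K: "K \<in> carrier_mat s (n + s)" and N: "N \<in> carrier_mat (n + s) n"
    and KN: "K * N = 0\<^sub>m s n"
    and Kind: "\<And>v. v \<in> carrier_vec s \<Longrightarrow> K\<^sup>T *\<^sub>v v = 0\<^sub>v (n + s) \<Longrightarrow> v = 0\<^sub>v s"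
    and Nind: "\<And>w. w \<in> carrier_vec n \<Longrightarrow> N *\<^sub>v w = 0\<^sub>v (n + s) \<Longrightarrow> w = 0\<^sub>v n"
  obtains X where "X \<in> carrier_mat (n + s) s" "K * X = 1\<^sub>m s" "det (append_cols N X) \<noteq> 0"
    "\<And>v. v \<in> carrier_vec (n + s) \<Longrightarrow> K *\<^sub>v v = 0\<^sub>v s \<Longrightarrow> \<exists>w \<in> carrier_vec n. v = N *\<^sub>v w"
proof -
  obtain X where X: "X \<in> carrier_mat (n + s) s" "K * X = 1\<^sub>m s"
    using right_inverse_if_left_kernel_trivial[OF K Kind] by blast
  let ?U = "append_cols N X"
  have U: "?U \<in> carrier_mat (n + s) (n + s)" using N X(1) by (rule append_cols_carrier)
  have Uv: "?U *\<^sub>v (a @\<^sub>v b) = N *\<^sub>v a + X *\<^sub>v b" if "a \<in> carrier_vec n" "b \<in> carrier_vec s" for a b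
    using N X(1) that by (rule append_cols_mult_append_vec)
  have KU: "K *\<^sub>v (N *\<^sub>v a + X *\<^sub>v b) = b" if a: "a \<in> carrier_vec n" and b: "b \<in> carrier_vec s" for a b
  proof -
    have "K *\<^sub>v (N *\<^sub>v a + X *\<^sub>v b) = K *\<^sub>v (N *\<^sub>v a) + K *\<^sub>v (X *\<^sub>v b)"
      using K N X a b by (intro mult_add_distrib_mat_vec) auto
    also have "\<dots> = (K * N) *\<^sub>v a + (K * X) *\<^sub>v b"
      using K N X(1) a b by (simp add: assoc_mult_mat_vec[of _ s "n + s"])
    also have "\<dots> = b" using KN X(2) a b by (auto intro!: eq_vecI)
    finally show ?thesis .
  qed
  have d: "det ?U \<noteq> 0"
  proof
    assume "det ?U = 0"
    then obtain v where v: "v \<in> carrier_vec (n + s)" "v \<noteq> 0\<^sub>v (n + s)" "?U *\<^sub>v v = 0\<^sub>v (n + s)"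
      using det_0_iff_vec_prod_zero_field[OF U] by auto
    obtain a b where ab: "a \<in> carrier_vec n" "b \<in> carrier_vec s" "v = a @\<^sub>v b"
      using v(1) by (rule append_vec_cases)
    have z: "N *\<^sub>v a + X *\<^sub>v b = 0\<^sub>v (n + s)" using Uv ab v(3) by simp
    then have b: "b = 0\<^sub>v s" using KU[OF ab(1,2)] K by (simp add: mult_mat_vec_def) auto
    have "X *\<^sub>v 0\<^sub>v s = 0\<^sub>v (n + s)" using X(1) by (auto intro!: eq_vecI)
    with z b have "N *\<^sub>v a = 0\<^sub>v (n + s)" using N ab by simp
    then have "a = 0\<^sub>v n" by (rule Nind[OF ab(1)])
    with b ab v(2) show False by (simp add: append_vec_eq_0_iff[OF zero_carrier_vec zero_carrier_vec])
  qed
  have ker: "\<exists>w \<in> carrier_vec n. v = N *\<^sub>v w" if v: "v \<in> carrier_vec (n + s)" "K *\<^sub>v v = 0\<^sub>v s" for v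
  proof -
    obtain V where V: "V \<in> carrier_mat (n + s) (n + s)" "?U * V = 1\<^sub>m (n + s)"
      using inverse_if_det_nonzero[OF U d] by blast
    have Vv: "V *\<^sub>v v \<in> carrier_vec (n + s)" using V(1) v(1) by (rule mult_mat_vec_carrier)
    then obtain a b where ab: "a \<in> carrier_vec n" "b \<in> carrier_vec s" "V *\<^sub>v v = a @\<^sub>v b"
      by (rule append_vec_cases)
    have "v = (?U * V) *\<^sub>v v" using V(2) v(1) by simp
    also have "\<dots> = N *\<^sub>v a + X *\<^sub>v b" using U V(1) v(1) ab Uv by (simp add: assoc_mult_mat_vec)
    finally have e: "v = N *\<^sub>v a + X *\<^sub>v b" .
    then have "b = 0\<^sub>v s" using KU[OF ab(1,2)] v(2) by simp
    then have "v = N *\<^sub>v a" using e N X(1) ab by (auto intro!: eq_vecI)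
    then show ?thesis using ab(1) by blast
  qed
  show thesis using X d ker by (rule that)
qed

text \<open>Multiplication by \<open>[N X]\<close> makes the pencil block triangular. With \<open>K X\<close> invertible at zero, the pencil is
  therefore regular as soon as \<open>M N\<close> is.\<close>

lemma det_pencil:
  fixes M K N X :: "'a::idom mat"
  assumes M: "M \<in> carrier_mat n (n + s)" and K: "K \<in> carrier_mat s (n + s)"
    and N: "N \<in> carrier_mat (n + s) n" and X: "X \<in> carrier_mat (n + s) s" and KN: "K * N = 0\<^sub>m s n"
  shows "det (M @\<^sub>r K) * det (append_cols N X) = det (M * N) * det (K * X)"
proof -
  have "det (M @\<^sub>r K) * det (append_cols N X) = det ((M @\<^sub>r K) * append_cols N X)"
    using carrier_append_rows[OF M K] append_cols_carrier[OF N X] by (rule det_mult[symmetric])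
  also have "\<dots> = det (four_block_mat (M * N) (M * X) (K * N) (K * X))"
    unfolding append_rows_mult_append_cols[OF M K N X] ..
  also have "\<dots> = det (M * N) * det (K * X)"
    using M K N X KN by (intro det_four_block_mat_lower_left_zero) auto
  finally show ?thesis .
qed

section \<open>Minimality at zero\<close>

text \<open>Since \<open>A\<close> is regular, \<open>[A; C]\<close> has full column rank over the rational functions; without an
  eigenvalue at zero it keeps this rank there.\<close>

lemma no_eigenvalue_0_imp_injective:
  fixes A C :: "'a::field poly mat"
  assumes A: "A \<in> carrier_mat n n" and C: "C \<in> carrier_mat p n" and det: "det A \<noteq> 0"
    and eig: "\<not> is_eigenvalue (rat_mat A @\<^sub>r rat_mat C) 0"
    and w: "w \<in> carrier_vec n" "(at0 A @\<^sub>r at0 C) *\<^sub>v w = 0\<^sub>v (n + p)"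
  shows "w = 0\<^sub>v n"
proof -
  have rA: "rat_mat A \<in> carrier_mat n n" and rC: "rat_mat C \<in> carrier_mat p n" using A C by simp_all
  have r: "rat_mat A @\<^sub>r rat_mat C \<in> carrier_mat (n + p) n" using rA rC by (rule carrier_append_rows)
  have z: "at0 A @\<^sub>r at0 C \<in> carrier_mat (n + p) n" using A C by simp
  have "v = 0\<^sub>v n" if v: "v \<in> carrier_vec n" "(rat_mat A @\<^sub>r rat_mat C) *\<^sub>v v = 0\<^sub>v (n + p)" for v
  proof -
    have "rat_mat A *\<^sub>v v = 0\<^sub>v n"
      using v(2) append_vec_eq_0_iff[OF mult_mat_vec_carrier[OF rA v(1)] mult_mat_vec_carrier[OF rC v(1)]]
      unfolding mat_mult_append[OF rA rC v(1)] by blast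
    moreover have "det (rat_mat A) \<noteq> 0" using det by (simp add: to_fract_hom.hom_det)
    ultimately show ?thesis using det_0_iff_vec_prod_zero_field[OF rA] v(1) by blast
  qed
  then have "mat_rank (rat_mat A @\<^sub>r rat_mat C) = n" unfolding mat_rank_eq_dim_col_iff[OF r] by blast
  then have "mat_rank (at0 A @\<^sub>r at0 C) = n"
    using eig mat_rank_le_dim_col[OF z]
    unfolding map_mat_append_rows[OF A C, symmetric] is_eigenvalue_rat_mat_iff by simp
  then show ?thesis using w unfolding mat_rank_eq_dim_col_iff[OF z] by blast
qed

lemma no_eigenvalue_0_imp_surjective:
  fixes A B :: "'a::field poly mat"
  assumes A: "A \<in> carrier_mat n n" and B: "B \<in> carrier_mat n m" and det: "det A \<noteq> 0"
    and eig: "\<not> is_eigenvalue (append_cols (rat_mat A) (rat_mat B)) 0"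
    and y: "y \<in> carrier_vec n"
  shows "\<exists>x \<in> carrier_vec (n + m). append_cols (at0 A) (at0 B) *\<^sub>v x = y"
proof -
  have rA: "rat_mat A \<in> carrier_mat n n" and rB: "rat_mat B \<in> carrier_mat n m" using A B by simp_all
  have r: "append_cols (rat_mat A) (rat_mat B) \<in> carrier_mat n (n + m)" using rA rB by (rule append_cols_carrier)
  have z: "append_cols (at0 A) (at0 B) \<in> carrier_mat n (n + m)" using A B by (intro append_cols_carrier) simp_all
  have "det (rat_mat A) \<noteq> 0" using det by (simp add: to_fract_hom.hom_det)
  then obtain Ai where Ai: "Ai \<in> carrier_mat n n" "rat_mat A * Ai = 1\<^sub>m n"
    using inverse_if_det_nonzero[OF rA] by blast
  have "\<exists>x \<in> carrier_vec (n + m). append_cols (rat_mat A) (rat_mat B) *\<^sub>v x = u"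
    if u: "u \<in> carrier_vec n" for u
  proof
    have Au: "Ai *\<^sub>v u \<in> carrier_vec n" using Ai(1) u by (rule mult_mat_vec_carrier)
    then show "(Ai *\<^sub>v u) @\<^sub>v 0\<^sub>v m \<in> carrier_vec (n + m)" by (rule append_carrier_vec) simp
    have "append_cols (rat_mat A) (rat_mat B) *\<^sub>v ((Ai *\<^sub>v u) @\<^sub>v 0\<^sub>v m)
        = rat_mat A *\<^sub>v (Ai *\<^sub>v u) + rat_mat B *\<^sub>v 0\<^sub>v m"
      using rA rB Au zero_carrier_vec by (rule append_cols_mult_append_vec)
    also have "rat_mat A *\<^sub>v (Ai *\<^sub>v u) = u"
      using assoc_mult_mat_vec[OF rA Ai(1) u] Ai(2) u by simp
    also have "rat_mat B *\<^sub>v 0\<^sub>v m = 0\<^sub>v n" using rB by (intro eq_vecI) auto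
    also have "u + 0\<^sub>v n = u" using u by simp
    finally show "append_cols (rat_mat A) (rat_mat B) *\<^sub>v ((Ai *\<^sub>v u) @\<^sub>v 0\<^sub>v m) = u" .
  qed
  then have "mat_rank (append_cols (rat_mat A) (rat_mat B)) = n" unfolding mat_rank_eq_dim_row_iff[OF r] by blast
  then have "mat_rank (append_cols (at0 A) (at0 B)) = n"
    using eig mat_rank_le_dim_row[OF z]
    unfolding map_mat_append_cols[OF A B, symmetric] is_eigenvalue_rat_mat_iff by simp
  then show ?thesis using y unfolding mat_rank_eq_dim_row_iff[OF z] by blast
qed

text \<open>A kernel vector lies in the kernel of \<open>K\<close>, which is the image of \<open>N\<close>; so injectivity has to be checked
  only after composition with \<open>N\<close>.\<close>

lemma pencil_state_output_injective:
  fixes M K N :: "'a::field mat"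
  assumes M: "M \<in> carrier_mat n (n + s)" and K: "K \<in> carrier_mat s (n + s)"
    and N: "N \<in> carrier_mat (n + s) n" and M': "M' \<in> carrier_mat p (n + s)"
    and ker: "\<And>v. v \<in> carrier_vec (n + s) \<Longrightarrow> K *\<^sub>v v = 0\<^sub>v s \<Longrightarrow> \<exists>w \<in> carrier_vec n. v = N *\<^sub>v w"
    and inj: "\<And>w. w \<in> carrier_vec n \<Longrightarrow> (M * N @\<^sub>r M' * N) *\<^sub>v w = 0\<^sub>v (n + p) \<Longrightarrow> w = 0\<^sub>v n"
    and v: "v \<in> carrier_vec (n + s)"
      "((M @\<^sub>r K) @\<^sub>r (M' @\<^sub>r 0\<^sub>m t (n + s))) *\<^sub>v v = 0\<^sub>v ((n + s) + (p + t))"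
  shows "v = 0\<^sub>v (n + s)"
proof -
  have "((M *\<^sub>v v) @\<^sub>v (K *\<^sub>v v)) @\<^sub>v ((M' *\<^sub>v v) @\<^sub>v (0\<^sub>m t (n + s) *\<^sub>v v)) = 0\<^sub>v ((n + s) + (p + t))"
    using v M K M'
    by (simp add: mat_mult_append[of _ "n + s" "n + s" _ "p + t"] mat_mult_append[of _ n "n + s" _ s]
        mat_mult_append[of _ p "n + s" _ t])
  moreover have c: "M *\<^sub>v v \<in> carrier_vec n" "K *\<^sub>v v \<in> carrier_vec s" "M' *\<^sub>v v \<in> carrier_vec p"
    "0\<^sub>m t (n + s) *\<^sub>v v \<in> carrier_vec t"
    using M K M' v(1) by (auto intro: mult_mat_vec_carrier simp: zero_mat_mult_vec)
  ultimately have z0: "(M *\<^sub>v v) @\<^sub>v (K *\<^sub>v v) = 0\<^sub>v (n + s)"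
    "(M' *\<^sub>v v) @\<^sub>v (0\<^sub>m t (n + s) *\<^sub>v v) = 0\<^sub>v (p + t)"
    using append_vec_eq_0_iff[OF append_carrier_vec[OF c(1,2)] append_carrier_vec[OF c(3,4)]] by blast+
  have z: "M *\<^sub>v v = 0\<^sub>v n" "K *\<^sub>v v = 0\<^sub>v s" "M' *\<^sub>v v = 0\<^sub>v p"
    using z0 append_vec_eq_0_iff[OF c(1,2)] append_vec_eq_0_iff[OF c(3,4)] by blast+
  obtain w where w: "w \<in> carrier_vec n" "v = N *\<^sub>v w" using ker[OF v(1) z(2)] by blast
  have "(M * N @\<^sub>r M' * N) *\<^sub>v w = (M * N *\<^sub>v w) @\<^sub>v (M' * N *\<^sub>v w)"
    using M N M' w by (intro mat_mult_append) auto
  also have "\<dots> = 0\<^sub>v n @\<^sub>v 0\<^sub>v p"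
    using M N M' w z by (simp add: assoc_mult_mat_vec[of _ _ "n + s" _ n])
  also have "\<dots> = 0\<^sub>v (n + p)" by (intro eq_vecI) auto
  finally have "w = 0\<^sub>v n" by (rule inj[OF w(1)])
  then show ?thesis using w(2) N by (auto intro!: eq_vecI)
qed

text \<open>The component of the target in the rows of \<open>K\<close> is reached by \<open>X b\<close>. Adding vectors \<open>N z\<close> and \<open>N' w\<close>
  does not disturb it and corrects the remaining component arbitrarily.\<close>

lemma pencil_state_input_surjective:
  fixes M K N :: "'a::field mat"
  assumes M: "M \<in> carrier_mat n (n + s)" and K: "K \<in> carrier_mat s (n + s)"
    and N: "N \<in> carrier_mat (n + s) n" and KN: "K * N = 0\<^sub>m s n"
    and X: "X \<in> carrier_mat (n + s) s" "K * X = 1\<^sub>m s"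
    and M': "M' \<in> carrier_mat n l" and N': "N' \<in> carrier_mat l m"
    and surj: "\<And>y. y \<in> carrier_vec n \<Longrightarrow> \<exists>x \<in> carrier_vec (n + m). append_cols (M * N) (M' * N') *\<^sub>v x = y"
    and y: "y \<in> carrier_vec (n + s)"
  shows "\<exists>x \<in> carrier_vec ((n + s) + l). append_cols (M @\<^sub>r K) (M' @\<^sub>r 0\<^sub>m s l) *\<^sub>v x = y"
proof -
  obtain a b where ab: "a \<in> carrier_vec n" "b \<in> carrier_vec s" "y = a @\<^sub>v b"
    using y by (rule append_vec_cases)
  have Xb: "X *\<^sub>v b \<in> carrier_vec (n + s)" using X(1) ab(2) by (rule mult_mat_vec_carrier)
  have MXb: "M *\<^sub>v (X *\<^sub>v b) \<in> carrier_vec n" using M Xb by (rule mult_mat_vec_carrier)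
  obtain x where x: "x \<in> carrier_vec (n + m)"
    "append_cols (M * N) (M' * N') *\<^sub>v x = a - M *\<^sub>v (X *\<^sub>v b)"
    using surj[of "a - M *\<^sub>v (X *\<^sub>v b)"] MXb ab by auto
  obtain z w where zw: "z \<in> carrier_vec n" "w \<in> carrier_vec m" "x = z @\<^sub>v w"
    using x(1) by (rule append_vec_cases)
  have Nz: "N *\<^sub>v z \<in> carrier_vec (n + s)" using N zw(1) by (rule mult_mat_vec_carrier)
  have Nw: "N' *\<^sub>v w \<in> carrier_vec l" using N' zw(2) by (rule mult_mat_vec_carrier)
  have MNz: "M *\<^sub>v (N *\<^sub>v z) \<in> carrier_vec n" using M Nz by (rule mult_mat_vec_carrier)
  have MNw: "M' *\<^sub>v (N' *\<^sub>v w) \<in> carrier_vec n" using M' Nw by (rule mult_mat_vec_carrier)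
  have e1: "M *\<^sub>v (N *\<^sub>v z) + M' *\<^sub>v (N' *\<^sub>v w) = a - M *\<^sub>v (X *\<^sub>v b)"
  proof -
    have "append_cols (M * N) (M' * N') *\<^sub>v x = (M * N) *\<^sub>v z + (M' * N') *\<^sub>v w"
      unfolding zw(3) using M N M' N' zw by (intro append_cols_mult_append_vec) auto
    then show ?thesis
      using x(2) M N M' N' zw by (simp add: assoc_mult_mat_vec[of _ n "n + s" _ n] assoc_mult_mat_vec[of _ n l _ m])
  qed
  have KNz: "K *\<^sub>v (N *\<^sub>v z) = 0\<^sub>v s"
  proof -
    have "K *\<^sub>v (N *\<^sub>v z) = (K * N) *\<^sub>v z" using K N zw by simp
    then show ?thesis using KN zw by auto
  qed
  have KXb: "K *\<^sub>v (X *\<^sub>v b) = b"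
  proof -
    have "K *\<^sub>v (X *\<^sub>v b) = (K * X) *\<^sub>v b" using K X(1) ab by simp
    then show ?thesis using X ab by simp
  qed
  have add_diff: "u + (a - u) = a" if "u \<in> carrier_vec n" for u
    using that ab(1) by (intro eq_vecI) auto
  let ?u = "X *\<^sub>v b + N *\<^sub>v z" and ?v = "N' *\<^sub>v w"
  have u: "?u \<in> carrier_vec (n + s)" using Xb Nz by simp
  have "append_cols (M @\<^sub>r K) (M' @\<^sub>r 0\<^sub>m s l) *\<^sub>v (?u @\<^sub>v ?v) = (M @\<^sub>r K) *\<^sub>v ?u + (M' @\<^sub>r 0\<^sub>m s l) *\<^sub>v ?v"
    using M K M' u Nw by (intro append_cols_mult_append_vec) auto
  also have "(M @\<^sub>r K) *\<^sub>v ?u = (M *\<^sub>v ?u) @\<^sub>v (K *\<^sub>v ?u)"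
    using M K u by (intro mat_mult_append)
  also have "M *\<^sub>v ?u = M *\<^sub>v (X *\<^sub>v b) + M *\<^sub>v (N *\<^sub>v z)"
    using M Xb Nz by (rule mult_add_distrib_mat_vec)
  also have "K *\<^sub>v ?u = b"
    using mult_add_distrib_mat_vec[OF K Xb Nz] KXb KNz ab by simp
  also have "(M' @\<^sub>r 0\<^sub>m s l) *\<^sub>v ?v = (M' *\<^sub>v ?v) @\<^sub>v 0\<^sub>v s"
    using mat_mult_append[OF M' zero_carrier_mat Nw, of s] zero_mat_mult_vec[OF Nw] by simp
  also have "((M *\<^sub>v (X *\<^sub>v b) + M *\<^sub>v (N *\<^sub>v z)) @\<^sub>v b) + ((M' *\<^sub>v ?v) @\<^sub>v 0\<^sub>v s)
      = (M *\<^sub>v (X *\<^sub>v b) + M *\<^sub>v (N *\<^sub>v z) + M' *\<^sub>v ?v) @\<^sub>v (b + 0\<^sub>v s)"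
    using MXb MNz MNw ab by (intro append_vec_add[of _ n _ _ s]) auto
  also have "M *\<^sub>v (X *\<^sub>v b) + M *\<^sub>v (N *\<^sub>v z) + M' *\<^sub>v ?v
      = M *\<^sub>v (X *\<^sub>v b) + (M *\<^sub>v (N *\<^sub>v z) + M' *\<^sub>v ?v)"
    using MXb MNz MNw by (rule assoc_add_vec)
  also have "\<dots> = a" unfolding e1 by (rule add_diff[OF MXb])
  finally have "append_cols (M @\<^sub>r K) (M' @\<^sub>r 0\<^sub>m s l) *\<^sub>v (?u @\<^sub>v ?v) = y" using ab by simp
  moreover have "?u @\<^sub>v ?v \<in> carrier_vec ((n + s) + l)" using u Nw by simp
  ultimately show ?thesis by blast
qed

section \<open>Equivalence of transfer functions at zero\<close>

definition const_mat :: "'a::zero mat \<Rightarrow> 'a poly mat" where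
  "const_mat = map_mat (\<lambda>c. [:c:])"

lemma const_mat_carrier: "G \<in> carrier_mat nr nc \<Longrightarrow> const_mat G \<in> carrier_mat nr nc"
  by (simp add: const_mat_def)

lemma at0_const_mat [simp]: "at0 (const_mat G) = G"
  by (intro eq_matI) (auto simp: const_mat_def)

text \<open>With a constant right inverse \<open>E\<close> of the value of \<open>[A B]\<close> at zero, \<open>H = [A B] E\<close> is the identity at zero.
  Multiplying \<open>E\<close> by the adjugate of \<open>H\<close> gives a polynomial right inverse up to the common
  denominator \<open>\<delta> = det H\<close>, which does not vanish at zero.\<close>

lemma controllable_solve:
  fixes A B Z :: "'a::field poly mat"
  assumes A: "A \<in> carrier_mat n n" and B: "B \<in> carrier_mat n m" and Z: "Z \<in> carrier_mat n k"
    and surj: "\<And>y. y \<in> carrier_vec n \<Longrightarrow>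
      \<exists>x \<in> carrier_vec (n + m). append_cols (at0 A) (at0 B) *\<^sub>v x = y"
  obtains F G \<delta> where "F \<in> carrier_mat n k" "G \<in> carrier_mat m k" "poly \<delta> 0 \<noteq> 0"
    "A * F + B * G = \<delta> \<cdot>\<^sub>m Z"
proof -
  let ?AB = "append_cols A B"
  have AB: "?AB \<in> carrier_mat n (n + m)" using A B by (rule append_cols_carrier)
  have AB0: "at0 ?AB \<in> carrier_mat n (n + m)" using AB by simp
  obtain E where E: "E \<in> carrier_mat (n + m) n" "at0 ?AB * E = 1\<^sub>m n"
    using mult_mat_vec_surj_imp_right_inverse[OF AB0] surj
    unfolding map_mat_append_cols[OF A B] by blast
  define H where "H = ?AB * const_mat E"
  have cE: "const_mat E \<in> carrier_mat (n + m) n" using E(1) by (rule const_mat_carrier)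
  have H: "H \<in> carrier_mat n n" unfolding H_def using AB cE by (rule mult_carrier_mat)
  have "at0 H = 1\<^sub>m n" unfolding H_def poly_0_hom.mat_hom_mult[OF AB cE] using E(2) by simp
  then have d: "poly (det H) 0 = 1" using poly_0_hom.hom_det[of H] by simp
  note adj = adj_mat[OF H]
  define T where "T = const_mat E * (adj_mat H * Z)"
  have aZ: "adj_mat H * Z \<in> carrier_mat n k" using adj(1) Z by (rule mult_carrier_mat)
  have T: "T \<in> carrier_mat (n + m) k" unfolding T_def using cE aZ by (rule mult_carrier_mat)
  define F where "F = mat n k (\<lambda>(i, j). T $$ (i, j))"
  define G where "G = mat m k (\<lambda>(i, j). T $$ (n + i, j))"
  have FG: "F \<in> carrier_mat n k" "G \<in> carrier_mat m k" by (auto simp: F_def G_def)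
  have TFG: "T = F @\<^sub>r G"
    using T FG by (intro eq_matI) (auto simp: append_rows_def F_def G_def)
  have "A * F + B * G = ?AB * T"
    unfolding TFG using A B FG by (rule append_cols_mult_append_rows[symmetric])
  also have "\<dots> = H * (adj_mat H * Z)"
    unfolding T_def by (subst assoc_mult_mat[OF AB cE aZ, symmetric]) (simp only: H_def)
  also have "\<dots> = (H * adj_mat H) * Z" using H adj(1) Z by (rule assoc_mult_mat[symmetric])
  also have "\<dots> = det H \<cdot>\<^sub>m Z"
    unfolding adj(2) using Z by (simp add: mult_smult_assoc_mat[of _ n n _ k])
  finally have "A * F + B * G = det H \<cdot>\<^sub>m Z" .
  then show thesis by (rule that[OF FG, rotated]) (simp add: d)
qed

text \<open>All transformations are written with a common denominator, a polynomial numerator matrix over a scalar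
  \<open>\<delta>\<close>; then regularity at zero only depends on two values at zero.\<close>

lemma regular_at_zeroI:
  fixes P :: "'a::field poly mat"
  assumes P: "P \<in> carrier_mat n n" and \<delta>: "poly \<delta> 0 \<noteq> 0" and d: "poly (det P) 0 \<noteq> 0"
  shows "regular_at_zero (inverse (to_fract \<delta>) \<cdot>\<^sub>m rat_mat P)"
proof -
  let ?Q = "inverse (to_fract \<delta>) \<cdot>\<^sub>m rat_mat P"
  have \<delta>0: "\<delta> \<noteq> 0" using \<delta> by auto
  have el: "?Q $$ (i, j) = Fract (P $$ (i, j)) \<delta>" if "i < n" "j < n" for i j
    using that P \<delta>0 by (simp add: to_fract_def)
  have "square_mat ?Q" using P by simp
  moreover have "finite_at r 0" if r: "r \<in> elements_mat ?Q" for r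
  proof -
    obtain i j where "i < n" "j < n" "r = ?Q $$ (i, j)" using elements_matD[OF r] P by auto
    with el[of i j] \<delta> show ?thesis unfolding finite_at_def by blast
  qed
  moreover have "invertible_mat (map_mat (rat_eval 0) ?Q)"
  proof -
    let ?E = "inverse (poly \<delta> 0) \<cdot>\<^sub>m at0 P"
    have e: "map_mat (rat_eval 0) ?Q = ?E"
    proof (intro eq_matI)
      fix i j assume "i < dim_row ?E" "j < dim_col ?E"
      then have ij: "i < n" "j < n" using P by auto
      then have "map_mat (rat_eval 0) ?Q $$ (i, j) = rat_eval 0 (Fract (P $$ (i, j)) \<delta>)"
        using el[OF ij] P by simp
      then show "map_mat (rat_eval 0) ?Q $$ (i, j) = ?E $$ (i, j)"
        using ij P \<delta> by (simp add: rat_eval_Fract divide_inverse)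
    qed auto
    have E: "?E \<in> carrier_mat n n" using P by simp
    have "det ?E \<noteq> 0" using d \<delta> P by (simp add: poly_0_hom.hom_det)
    then obtain B where B: "B \<in> carrier_mat n n" "?E * B = 1\<^sub>m n" "B * ?E = 1\<^sub>m n"
      using inverse_if_det_nonzero[OF E] by blast
    then show ?thesis unfolding e invertible_mat_def inverts_mat_def using P
      by (auto intro!: exI[of _ B])
  qed
  ultimately show ?thesis unfolding regular_at_zero_def by blast
qed

lemma smult_inverse_rat_mat_mult:
  fixes P Q :: "'a::field poly mat"
  assumes "P \<in> carrier_mat r n" "Q \<in> carrier_mat n c"
  shows "(inverse (to_fract \<delta>) \<cdot>\<^sub>m rat_mat P) * (inverse (to_fract \<epsilon>) \<cdot>\<^sub>m rat_mat Q)
    = inverse (to_fract (\<delta> * \<epsilon>)) \<cdot>\<^sub>m rat_mat (P * Q)"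
proof -
  have "(inverse (to_fract \<delta>) \<cdot>\<^sub>m rat_mat P) * (inverse (to_fract \<epsilon>) \<cdot>\<^sub>m rat_mat Q)
    = inverse (to_fract \<epsilon>) \<cdot>\<^sub>m (inverse (to_fract \<delta>) \<cdot>\<^sub>m (rat_mat P * rat_mat Q))"
    using assms
    by (simp add: mult_smult_assoc_mat[of _ r n _ c] mult_smult_distrib[of _ r n _ c])
  also have "\<dots> = inverse (to_fract (\<delta> * \<epsilon>)) \<cdot>\<^sub>m rat_mat (P * Q)"
    unfolding to_fract_hom.mat_hom_mult[OF assms]
    by (intro eq_matI) (auto simp: ac_simps)
  finally show ?thesis .
qed

text \<open>The pole that the inverse \<open>Ai\<close> causes in the last summand is the same as the one in \<open>(D + C Ai B) G\<close>:
  since \<open>Ai A F = F\<close>, the difference involves no inverse.\<close>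

lemma feedthrough_identity:
  fixes A B C D F G V Ai :: "'a::comm_ring_1 mat"
  assumes A: "A \<in> carrier_mat n n" and B: "B \<in> carrier_mat n m" and C: "C \<in> carrier_mat p n"
    and D: "D \<in> carrier_mat p m" and F: "F \<in> carrier_mat n k" and G: "G \<in> carrier_mat m k"
    and V: "V \<in> carrier_mat p k" and Ai: "Ai \<in> carrier_mat n n" and AiA: "Ai * A = 1\<^sub>m n"
  shows "(D + C * Ai * B) * G + (V + C * F - D * G) = V + C * Ai * (A * F + B * G)"
proof -
  have CAi: "C * Ai \<in> carrier_mat p n" using C Ai by (rule mult_carrier_mat)
  have "C * Ai * (A * F) = C * (Ai * (A * F))"
    using C Ai mult_carrier_mat[OF A F] by (rule assoc_mult_mat)
  also have "Ai * (A * F) = (Ai * A) * F" using Ai A F by (rule assoc_mult_mat[symmetric])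
  finally have 1: "C * Ai * (A * F) = C * F" using AiA F by simp
  have 2: "C * Ai * (B * G) = C * Ai * B * G" using CAi B G by (rule assoc_mult_mat[symmetric])
  have 3: "C * Ai * (A * F + B * G) = C * F + C * Ai * B * G"
    unfolding 1[symmetric] 2[symmetric]
    using CAi mult_carrier_mat[OF A F] mult_carrier_mat[OF B G] by (rule mult_add_distrib_mat)
  have 4: "(D + C * Ai * B) * G = D * G + C * Ai * B * G"
    using D mult_carrier_mat[OF CAi B] G by (rule add_mult_distrib_mat)
  have cancel: "X + Y + (V + Z - X) = V + (Z + Y)"
    if "X \<in> carrier_mat p k" "Y \<in> carrier_mat p k" "Z \<in> carrier_mat p k" for X Y Z
    using that V by (intro eq_matI) auto
  have "D * G \<in> carrier_mat p k" "C * F \<in> carrier_mat p k" "C * Ai * B * G \<in> carrier_mat p k"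
    using CAi B C D F G by (auto intro!: mult_carrier_mat)
  then show ?thesis unfolding 3 4 by (intro cancel)
qed

lemma block_equivalence:
  fixes R Y W G :: "'a::comm_ring_1 mat"
  assumes R: "R \<in> carrier_mat p m" and Y: "Y \<in> carrier_mat p s" and W: "W \<in> carrier_mat s s"
    and G: "G \<in> carrier_mat m s"
  shows "four_block_mat (1\<^sub>m p) Y (0\<^sub>m s p) W * four_block_mat R (0\<^sub>m p s) (0\<^sub>m s m) (1\<^sub>m s)
      * four_block_mat (1\<^sub>m m) G (0\<^sub>m s m) (1\<^sub>m s)
    = four_block_mat R (R * G + Y) (0\<^sub>m s m) W"
proof -
  have "four_block_mat (1\<^sub>m p) Y (0\<^sub>m s p) W * four_block_mat R (0\<^sub>m p s) (0\<^sub>m s m) (1\<^sub>m s)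
    = four_block_mat (1\<^sub>m p * R + Y * 0\<^sub>m s m) (1\<^sub>m p * 0\<^sub>m p s + Y * 1\<^sub>m s)
        (0\<^sub>m s p * R + W * 0\<^sub>m s m) (0\<^sub>m s p * 0\<^sub>m p s + W * 1\<^sub>m s)"
    using R Y W by (intro mult_four_block_mat) auto
  also have "\<dots> = four_block_mat R Y (0\<^sub>m s m) W" using R Y W by simp
  also have "\<dots> * four_block_mat (1\<^sub>m m) G (0\<^sub>m s m) (1\<^sub>m s)
    = four_block_mat (R * 1\<^sub>m m + Y * 0\<^sub>m s m) (R * G + Y * 1\<^sub>m s)
        (0\<^sub>m s m * 1\<^sub>m m + W * 0\<^sub>m s m) (0\<^sub>m s m * G + W * 1\<^sub>m s)"
    using R Y W G by (intro mult_four_block_mat) auto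
  also have "\<dots> = four_block_mat R (R * G + Y) (0\<^sub>m s m) W" using R Y W G by simp
  finally show ?thesis .
qed

text \<open>The pencil maps \<open>NA Ai MB\<close> to \<open>MB\<close> on top of zero, so this is what its inverse makes of the input block.\<close>

lemma pencil_transfer_function:
  fixes MA KA NA MB MC MD KD Li Ai A C :: "'a::comm_ring_1 mat"
  assumes MA: "MA \<in> carrier_mat n (n + s)" and KA: "KA \<in> carrier_mat s (n + s)"
    and NA: "NA \<in> carrier_mat (n + s) n" and KN: "KA * NA = 0\<^sub>m s n"
    and A: "A = MA * NA" and C: "C = MC * NA"
    and MB: "MB \<in> carrier_mat n l" and MC: "MC \<in> carrier_mat p (n + s)"
    and MD: "MD \<in> carrier_mat p l" and KD: "KD \<in> carrier_mat t l"
    and Li: "Li \<in> carrier_mat (n + s) (n + s)" "Li * (MA @\<^sub>r KA) = 1\<^sub>m (n + s)"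
    and Ai: "Ai \<in> carrier_mat n n" "A * Ai = 1\<^sub>m n"
  shows "(MD @\<^sub>r KD) + (MC @\<^sub>r 0\<^sub>m t (n + s)) * Li * (MB @\<^sub>r 0\<^sub>m s l) = (MD + C * Ai * MB) @\<^sub>r KD"
proof -
  have A': "A \<in> carrier_mat n n" unfolding A using MA NA by (rule mult_carrier_mat)
  have C': "C \<in> carrier_mat p n" unfolding C using MC NA by (rule mult_carrier_mat)
  have L: "MA @\<^sub>r KA \<in> carrier_mat (n + s) (n + s)" using MA KA by (rule carrier_append_rows)
  have AiMB: "Ai * MB \<in> carrier_mat n l" using Ai(1) MB by (rule mult_carrier_mat)
  have NAiMB: "NA * (Ai * MB) \<in> carrier_mat (n + s) l" using NA AiMB by (rule mult_carrier_mat)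
  have "(MA @\<^sub>r KA) * (NA * (Ai * MB)) = (MA * (NA * (Ai * MB))) @\<^sub>r (KA * (NA * (Ai * MB)))"
    using MA KA NAiMB by (rule append_rows_mult)
  also have "MA * (NA * (Ai * MB)) = A * (Ai * MB)"
    unfolding A using MA NA AiMB by (rule assoc_mult_mat[symmetric])
  also have "\<dots> = (A * Ai) * MB" using A' Ai(1) MB by (rule assoc_mult_mat[symmetric])
  also have "\<dots> = MB" using Ai(2) MB by simp
  also have "KA * (NA * (Ai * MB)) = (KA * NA) * (Ai * MB)"
    using KA NA AiMB by (rule assoc_mult_mat[symmetric])
  also have "\<dots> = 0\<^sub>m s l" unfolding KN using AiMB by (rule left_mult_zero_mat)
  finally have e: "(MA @\<^sub>r KA) * (NA * (Ai * MB)) = MB @\<^sub>r 0\<^sub>m s l" .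
  have "Li * (MB @\<^sub>r 0\<^sub>m s l) = (Li * (MA @\<^sub>r KA)) * (NA * (Ai * MB))"
    unfolding e[symmetric] using Li(1) L NAiMB by (rule assoc_mult_mat[symmetric])
  also have "\<dots> = NA * (Ai * MB)" unfolding Li(2) using NAiMB by (rule left_mult_one_mat)
  finally have Le: "Li * (MB @\<^sub>r 0\<^sub>m s l) = NA * (Ai * MB)" .
  have MB0: "MB @\<^sub>r 0\<^sub>m s l \<in> carrier_mat (n + s) l" using MB by simp
  have MC0: "MC @\<^sub>r 0\<^sub>m t (n + s) \<in> carrier_mat (p + t) (n + s)" using MC by simp
  have "(MC @\<^sub>r 0\<^sub>m t (n + s)) * Li * (MB @\<^sub>r 0\<^sub>m s l) = (MC @\<^sub>r 0\<^sub>m t (n + s)) * (NA * (Ai * MB))"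
    unfolding Le[symmetric] using MC0 Li(1) MB0 by (rule assoc_mult_mat)
  also have "\<dots> = (MC * (NA * (Ai * MB))) @\<^sub>r (0\<^sub>m t (n + s) * (NA * (Ai * MB)))"
    using MC zero_carrier_mat NAiMB by (rule append_rows_mult)
  also have "MC * (NA * (Ai * MB)) = C * (Ai * MB)"
    unfolding C using MC NA AiMB by (rule assoc_mult_mat[symmetric])
  also have "\<dots> = C * Ai * MB" using C' Ai(1) MB by (rule assoc_mult_mat[symmetric])
  also have "0\<^sub>m t (n + s) * (NA * (Ai * MB)) = 0\<^sub>m t l" using NAiMB by (rule left_mult_zero_mat)
  finally have f: "(MC @\<^sub>r 0\<^sub>m t (n + s)) * Li * (MB @\<^sub>r 0\<^sub>m s l) = (C * Ai * MB) @\<^sub>r 0\<^sub>m t l" .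
  have "C * Ai * MB \<in> carrier_mat p l" using C' Ai(1) MB by auto
  moreover have "(MD @\<^sub>r KD) + (Y @\<^sub>r 0\<^sub>m t l) = (MD + Y) @\<^sub>r KD" if "Y \<in> carrier_mat p l" for Y
    using that MD KD by (intro eq_matI) (auto simp: append_rows_def)
  ultimately show ?thesis unfolding f by blast
qed

lemma smult_inverse_rat_mat:
  "\<delta> \<noteq> 0 \<Longrightarrow> inverse (to_fract \<delta>) \<cdot>\<^sub>m rat_mat (\<delta> \<cdot>\<^sub>m P) = rat_mat P"
  by (intro eq_matI) auto

lemma smult_four_block:
  assumes "A \<in> carrier_mat nr1 nc1" "B \<in> carrier_mat nr1 nc2" "C \<in> carrier_mat nr2 nc1" "D \<in> carrier_mat nr2 nc2"
  shows "c \<cdot>\<^sub>m rat_mat (four_block_mat A B C D)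
    = four_block_mat (c \<cdot>\<^sub>m rat_mat A) (c \<cdot>\<^sub>m rat_mat B) (c \<cdot>\<^sub>m rat_mat C) (c \<cdot>\<^sub>m rat_mat D)"
  using assms by (intro eq_matI) auto

text \<open>The factorization
  \<open>[R  R G + Y; 0  W] = [1 Y; 0 W] [R 0; 0 1] [1 G; 0 1]\<close>
  of the transfer function after multiplication by \<open>U = [N X]\<close>, brought back by the inverse of \<open>U\<close>.\<close>

proposition transfer_function_equivalence_at_zero:
  fixes A B C D MB MD K N :: "'a::field poly mat"
  assumes A: "A \<in> carrier_mat n n" and B: "B = MB * N" and C: "C \<in> carrier_mat p n" and D: "D = MD * N"
    and MB: "MB \<in> carrier_mat n (m + s)" and MD: "MD \<in> carrier_mat p (m + s)"
    and K: "K \<in> carrier_mat s (m + s)" and N: "N \<in> carrier_mat (m + s) m" and KN: "K * N = 0\<^sub>m s m"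
    and Kind: "\<And>v. v \<in> carrier_vec s \<Longrightarrow> (at0 K)\<^sup>T *\<^sub>v v = 0\<^sub>v (m + s) \<Longrightarrow> v = 0\<^sub>v s"
    and Nind: "\<And>w. w \<in> carrier_vec m \<Longrightarrow> at0 N *\<^sub>v w = 0\<^sub>v (m + s) \<Longrightarrow> w = 0\<^sub>v m"
    and surj: "\<And>y. y \<in> carrier_vec n \<Longrightarrow>
      \<exists>x \<in> carrier_vec (n + m). append_cols (at0 A) (at0 B) *\<^sub>v x = y"
    and Ai: "Ai \<in> carrier_mat n n" "Ai * rat_mat A = 1\<^sub>m n"
  shows "\<exists>Q\<^sub>1 \<in> carrier_mat (p + s) (p + s). \<exists>Q\<^sub>2 \<in> carrier_mat (m + s) (m + s).
    regular_at_zero Q\<^sub>1 \<and> regular_at_zero Q\<^sub>2 \<and>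
    Q\<^sub>1 * four_block_mat (rat_mat D + rat_mat C * Ai * rat_mat B) (0\<^sub>m p s) (0\<^sub>m s m) (1\<^sub>m s) * Q\<^sub>2
      = (rat_mat MD + rat_mat C * Ai * rat_mat MB) @\<^sub>r rat_mat K"
proof -
  have B': "B \<in> carrier_mat n m" unfolding B using MB N by (rule mult_carrier_mat)
  have D': "D \<in> carrier_mat p m" unfolding D using MD N by (rule mult_carrier_mat)
  have K0: "at0 K \<in> carrier_mat s (m + s)" and N0: "at0 N \<in> carrier_mat (m + s) m" using K N by simp_all
  have KN0: "at0 K * at0 N = 0\<^sub>m s m"
    unfolding poly_0_hom.mat_hom_mult[OF K N, symmetric] KN by (intro eq_matI) auto
  obtain X0 where X0: "X0 \<in> carrier_mat (m + s) s" "at0 K * X0 = 1\<^sub>m s"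
    "det (append_cols (at0 N) X0) \<noteq> 0"
    using dual_completion_field[OF K0 N0 KN0 Kind Nind] by blast
  define X where "X = const_mat X0"
  have X: "X \<in> carrier_mat (m + s) s" unfolding X_def using X0(1) by (rule const_mat_carrier)
  define U where "U = append_cols N X"
  have U: "U \<in> carrier_mat (m + s) (m + s)" unfolding U_def using N X by (rule append_cols_carrier)
  have dU: "poly (det U) 0 \<noteq> 0"
    using X0(3) unfolding U_def poly_0_hom.hom_det[symmetric] map_mat_append_cols[OF N X]
    by (simp add: X_def)
  define W where "W = K * X"
  have W: "W \<in> carrier_mat s s" unfolding W_def using K X by (rule mult_carrier_mat)
  have "at0 W = 1\<^sub>m s" unfolding W_def poly_0_hom.mat_hom_mult[OF K X] using X0(2) by (simp add: X_def)
  then have dW: "poly (det W) 0 = 1" using poly_0_hom.hom_det[of W] by simp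
  have Z: "MB * X \<in> carrier_mat n s" using MB X by (rule mult_carrier_mat)
  obtain F G \<delta> where F: "F \<in> carrier_mat n s" and G: "G \<in> carrier_mat m s" and \<delta>: "poly \<delta> 0 \<noteq> 0"
    and FG: "A * F + B * G = \<delta> \<cdot>\<^sub>m (MB * X)"
    using controllable_solve[OF A B' Z surj] by blast
  have \<delta>0: "\<delta> \<noteq> 0" using \<delta> by auto
  let ?\<delta> = "inverse (to_fract \<delta>)"
  define Y where "Y = \<delta> \<cdot>\<^sub>m (MD * X) + C * F - D * G"
  have MDX: "MD * X \<in> carrier_mat p s" using MD X by (rule mult_carrier_mat)
  have CF: "C * F \<in> carrier_mat p s" using C F by (rule mult_carrier_mat)
  have DG: "D * G \<in> carrier_mat p s" using D' G by (rule mult_carrier_mat)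
  have Y: "Y \<in> carrier_mat p s" unfolding Y_def by (intro minus_carrier_mat DG)
  \<comment> \<open>\<open>P1\<close> and \<open>J\<close> are \<open>\<delta>\<close> times the outer factors \<open>[1 Y; 0 W]\<close> and \<open>[1 G; 0 1]\<close> over the common denominator: \<open>Y\<close> and \<open>G\<close> are here the numerators.\<close>
  define P1 where "P1 = four_block_mat (\<delta> \<cdot>\<^sub>m 1\<^sub>m p) Y (0\<^sub>m s p) (\<delta> \<cdot>\<^sub>m W)"
  define J where "J = four_block_mat (\<delta> \<cdot>\<^sub>m 1\<^sub>m m) G (0\<^sub>m s m) (\<delta> \<cdot>\<^sub>m 1\<^sub>m s)"
  have P1: "P1 \<in> carrier_mat (p + s) (p + s)" unfolding P1_def using W by simp
  have J: "J \<in> carrier_mat (m + s) (m + s)" unfolding J_def by simp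
  have dP1: "poly (det P1) 0 \<noteq> 0"
    using det_four_block_mat_lower_left_zero[OF _ Y refl, of "\<delta> \<cdot>\<^sub>m 1\<^sub>m p" "\<delta> \<cdot>\<^sub>m W"] W \<delta> dW
    unfolding P1_def by simp
  have dJ: "poly (det J) 0 \<noteq> 0"
    using det_four_block_mat_lower_left_zero[OF _ G refl, of "\<delta> \<cdot>\<^sub>m 1\<^sub>m m" "\<delta> \<cdot>\<^sub>m 1\<^sub>m s"] \<delta>
    unfolding J_def by simp
  note adj = adj_mat[OF U]
  have "det (adj_mat U) * det U = det (det U \<cdot>\<^sub>m 1\<^sub>m (m + s) :: 'a poly mat)"
    unfolding adj(3)[symmetric] using adj(1) U by (rule det_mult[symmetric])
  also have "\<dots> = det U ^ (m + s)" by simp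
  finally have "poly (det (adj_mat U)) 0 * poly (det U) 0 = poly (det U) 0 ^ (m + s)"
    by (metis poly_mult poly_power)
  with dU have dadj: "poly (det (adj_mat U)) 0 \<noteq> 0" by auto
  \<comment> \<open>The inverse of \<open>U\<close> enters \<open>Q2\<close> as its adjugate, with \<open>det U\<close> in the denominator.\<close>
  define Q1 where "Q1 = ?\<delta> \<cdot>\<^sub>m rat_mat P1"
  define Q2 where "Q2 = inverse (to_fract (\<delta> * det U)) \<cdot>\<^sub>m rat_mat (J * adj_mat U)"
  have Q1: "Q1 \<in> carrier_mat (p + s) (p + s)" unfolding Q1_def using P1 by simp
  have JU: "J * adj_mat U \<in> carrier_mat (m + s) (m + s)" using J adj(1) by (rule mult_carrier_mat)
  have Q2: "Q2 \<in> carrier_mat (m + s) (m + s)" unfolding Q2_def using JU by simp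
  have r1: "regular_at_zero Q1" unfolding Q1_def using P1 \<delta> dP1 by (rule regular_at_zeroI)
  have r2: "regular_at_zero Q2" unfolding Q2_def using JU
    by (rule regular_at_zeroI) (use \<delta> dU dJ dadj det_mult[OF J adj(1)] in auto)

  define R where "R = rat_mat D + rat_mat C * Ai * rat_mat B"
  define S where "S = rat_mat MD + rat_mat C * Ai * rat_mat MB"
  have rC: "rat_mat C \<in> carrier_mat p n" and rMB: "rat_mat MB \<in> carrier_mat n (m + s)"
    and rMD: "rat_mat MD \<in> carrier_mat p (m + s)" and rN: "rat_mat N \<in> carrier_mat (m + s) m"
    and rX: "rat_mat X \<in> carrier_mat (m + s) s" and rK: "rat_mat K \<in> carrier_mat s (m + s)"
    and rU: "rat_mat U \<in> carrier_mat (m + s) (m + s)" and rB: "rat_mat B \<in> carrier_mat n m"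
    and rD: "rat_mat D \<in> carrier_mat p m" and rA: "rat_mat A \<in> carrier_mat n n"
    using A B' C D' MB MD N X K U by simp_all
  have CAi: "rat_mat C * Ai \<in> carrier_mat p n" using rC Ai(1) by (rule mult_carrier_mat)
  have CAiMB: "rat_mat C * Ai * rat_mat MB \<in> carrier_mat p (m + s)" using CAi rMB by (rule mult_carrier_mat)
  have R: "R \<in> carrier_mat p m" unfolding R_def using rD CAi rB by auto
  have S: "S \<in> carrier_mat p (m + s)" unfolding S_def using rMD CAiMB by auto
  have SK: "S @\<^sub>r rat_mat K \<in> carrier_mat (p + s) (m + s)" using S rK by (rule carrier_append_rows)
  define Fq where "Fq = ?\<delta> \<cdot>\<^sub>m rat_mat F"
  define Gq where "Gq = ?\<delta> \<cdot>\<^sub>m rat_mat G"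
  have Fq: "Fq \<in> carrier_mat n s" and Gq: "Gq \<in> carrier_mat m s"
    using F G by (simp_all add: Fq_def Gq_def)
  have sm: "rat_mat L * (?\<delta> \<cdot>\<^sub>m rat_mat H) = ?\<delta> \<cdot>\<^sub>m rat_mat (L * H)"
    if "L \<in> carrier_mat a b" "H \<in> carrier_mat b c" for L H :: "'a poly mat" and a b c
    using that by (simp add: to_fract_hom.mat_hom_mult[of _ a b _ c] mult_smult_distrib[of _ a b _ c])
  have "rat_mat A * Fq + rat_mat B * Gq = ?\<delta> \<cdot>\<^sub>m rat_mat (A * F + B * G)"
    unfolding Fq_def Gq_def sm[OF A F] sm[OF B' G]
    using A F B' G by (intro eq_matI) (auto simp: distrib_left)
  also have "\<dots> = rat_mat (MB * X)" unfolding FG using \<delta>0 by (rule smult_inverse_rat_mat)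
  finally have FGq: "rat_mat A * Fq + rat_mat B * Gq = rat_mat (MB * X)" .
  have rMDX: "rat_mat (MD * X) \<in> carrier_mat p s" using MDX by simp
  have Yq: "?\<delta> \<cdot>\<^sub>m rat_mat Y = rat_mat (MD * X) + rat_mat C * Fq - rat_mat D * Gq"
  proof -
    have "?\<delta> \<cdot>\<^sub>m rat_mat (\<delta> \<cdot>\<^sub>m H + I - L) = rat_mat H + ?\<delta> \<cdot>\<^sub>m rat_mat I - ?\<delta> \<cdot>\<^sub>m rat_mat L"
      if "H \<in> carrier_mat p s" "I \<in> carrier_mat p s" "L \<in> carrier_mat p s" for H I L
      using that \<delta>0 by (intro eq_matI) (auto simp: algebra_simps)
    then show ?thesis unfolding Fq_def Gq_def sm[OF C F] sm[OF D' G] Y_def using MDX CF DG by blast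
  qed
  have RY: "R * Gq + ?\<delta> \<cdot>\<^sub>m rat_mat Y = S * rat_mat X"
  proof -
    have "R * Gq + ?\<delta> \<cdot>\<^sub>m rat_mat Y = rat_mat (MD * X) + rat_mat C * Ai * rat_mat (MB * X)"
      unfolding R_def Yq FGq[symmetric]
      using rA rB rC rD Fq Gq rMDX Ai by (rule feedthrough_identity)
    also have "\<dots> = rat_mat MD * rat_mat X + rat_mat C * Ai * (rat_mat MB * rat_mat X)"
      by (simp only: to_fract_hom.mat_hom_mult[OF MD X] to_fract_hom.mat_hom_mult[OF MB X])
    also have "rat_mat C * Ai * (rat_mat MB * rat_mat X) = (rat_mat C * Ai * rat_mat MB) * rat_mat X"
      using CAi rMB rX by (rule assoc_mult_mat[symmetric])
    also have "rat_mat MD * rat_mat X + \<dots> = S * rat_mat X"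
      unfolding S_def using rMD CAiMB rX by (rule add_mult_distrib_mat[symmetric])
    finally show ?thesis .
  qed
  have SN: "S * rat_mat N = R"
  proof -
    have "S * rat_mat N = rat_mat MD * rat_mat N + (rat_mat C * Ai * rat_mat MB) * rat_mat N"
      unfolding S_def using rMD CAiMB rN by (rule add_mult_distrib_mat)
    also have "(rat_mat C * Ai * rat_mat MB) * rat_mat N = rat_mat C * Ai * (rat_mat MB * rat_mat N)"
      using CAi rMB rN by (rule assoc_mult_mat)
    finally show ?thesis
      by (simp only: R_def B D to_fract_hom.mat_hom_mult[OF MD N] to_fract_hom.mat_hom_mult[OF MB N])
  qed
  have SU: "(S @\<^sub>r rat_mat K) * rat_mat U = four_block_mat R (S * rat_mat X) (0\<^sub>m s m) (rat_mat W)"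
  proof -
    have "rat_mat K * rat_mat N = 0\<^sub>m s m"
      unfolding to_fract_hom.mat_hom_mult[OF K N, symmetric] KN by (intro eq_matI) auto
    then show ?thesis
      unfolding U_def map_mat_append_cols[OF N X] append_rows_mult_append_cols[OF S rK rN rX] SN
      by (simp only: W_def to_fract_hom.mat_hom_mult[OF K X])
  qed
  let ?E = "four_block_mat R (0\<^sub>m p s) (0\<^sub>m s m) (1\<^sub>m s)"
  have E: "?E \<in> carrier_mat (p + s) (m + s)" using R by simp
  have Q1E: "Q1 * ?E \<in> carrier_mat (p + s) (m + s)" using Q1 E by (rule mult_carrier_mat)
  let ?J = "?\<delta> \<cdot>\<^sub>m rat_mat J"
  have J': "?J \<in> carrier_mat (m + s) (m + s)" using J by simp
  have id: "?\<delta> \<cdot>\<^sub>m rat_mat (\<delta> \<cdot>\<^sub>m 1\<^sub>m k) = 1\<^sub>m k" for k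
    unfolding smult_inverse_rat_mat[OF \<delta>0] by (rule to_fract_hom.mat_hom_one)
  have z: "?\<delta> \<cdot>\<^sub>m rat_mat (0\<^sub>m a b) = 0\<^sub>m a b" for a b by (intro eq_matI) auto
  have Q1_block: "Q1 = four_block_mat (1\<^sub>m p) (?\<delta> \<cdot>\<^sub>m rat_mat Y) (0\<^sub>m s p) (rat_mat W)"
    unfolding Q1_def P1_def using W Y
    by (subst smult_four_block[of _ p p _ s _ s]) (simp_all only: id to_fract_hom.mat_hom_one z smult_inverse_rat_mat[OF \<delta>0] smult_carrier_mat one_carrier_mat zero_carrier_mat)
  have J_block: "?J = four_block_mat (1\<^sub>m m) Gq (0\<^sub>m s m) (1\<^sub>m s)"
    unfolding J_def Gq_def using G
    by (subst smult_four_block[of _ m m _ s _ s]) (simp_all only: id to_fract_hom.mat_hom_one z smult_carrier_mat one_carrier_mat zero_carrier_mat)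
  have rY: "?\<delta> \<cdot>\<^sub>m rat_mat Y \<in> carrier_mat p s" and rW: "rat_mat W \<in> carrier_mat s s"
    using Y W by simp_all
  have key: "Q1 * ?E * ?J = (S @\<^sub>r rat_mat K) * rat_mat U"
    unfolding Q1_block J_block SU RY[symmetric] using R rY rW Gq by (rule block_equivalence)
  let ?V = "inverse (to_fract (det U)) \<cdot>\<^sub>m rat_mat (adj_mat U)"
  have V: "?V \<in> carrier_mat (m + s) (m + s)" using adj(1) by simp
  have dU0: "det U \<noteq> 0" using dU by auto
  have "rat_mat U * ?V = inverse (to_fract (det U)) \<cdot>\<^sub>m (rat_mat U * rat_mat (adj_mat U))"
    using rU adj(1) by (intro mult_smult_distrib) auto
  also have "\<dots> = inverse (to_fract (det U)) \<cdot>\<^sub>m rat_mat (det U \<cdot>\<^sub>m 1\<^sub>m (m + s))"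
    by (simp only: to_fract_hom.mat_hom_mult[OF U adj(1), symmetric] adj(2))
  also have "\<dots> = 1\<^sub>m (m + s)"
    unfolding smult_inverse_rat_mat[OF dU0] by (rule to_fract_hom.mat_hom_one)
  finally have UV: "rat_mat U * ?V = 1\<^sub>m (m + s)" .
  have "Q1 * ?E * Q2 = Q1 * ?E * (?J * ?V)"
    unfolding Q2_def smult_inverse_rat_mat_mult[OF J adj(1)] ..
  also have "\<dots> = Q1 * ?E * ?J * ?V" using Q1E J' V by (rule assoc_mult_mat[symmetric])
  also have "\<dots> = (S @\<^sub>r rat_mat K) * (rat_mat U * ?V)"
    unfolding key using SK rU V by (rule assoc_mult_mat)
  also have "\<dots> = S @\<^sub>r rat_mat K" unfolding UV using SK by (rule right_mult_one_mat)
  finally show ?thesis using Q1 Q2 r1 r2 unfolding R_def S_def by blast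
qed

section \<open>Linearization at infinity\<close>

theorem theorem4p4:
  fixes R :: "'a::alg_closed_field poly fract mat"
    and A B C D M\<^sub>A K\<^sub>A N\<^sub>A M\<^sub>D K\<^sub>D N\<^sub>D M\<^sub>B M\<^sub>C :: "'a poly mat"
    and n p m \<rho>\<^sub>A \<rho>\<^sub>D :: nat
  assumes "A \<in> carrier_mat n n" "B \<in> carrier_mat n m" "C \<in> carrier_mat p n" "D \<in> carrier_mat p m"
    and "det A \<noteq> 0"
    and "R = rat_mat D + rat_mat C * the (mat_inverse (rat_mat A)) * rat_mat B"
    and "M\<^sub>A \<in> carrier_mat n ((\<rho>\<^sub>A + 1) * n)" "K\<^sub>A \<in> carrier_mat (\<rho>\<^sub>A * n) ((\<rho>\<^sub>A + 1) * n)"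
    and "strong_block_minimal_basis_pencil M\<^sub>A K\<^sub>A"
    and "dual_minimal_bases K\<^sub>A N\<^sub>A" "equal_row_degrees N\<^sub>A" "\<rho>\<^sub>A = mat_degree N\<^sub>A"
    and "M\<^sub>A * transpose_mat N\<^sub>A = A"
    and "M\<^sub>D \<in> carrier_mat p ((\<rho>\<^sub>D + 1) * m)" "K\<^sub>D \<in> carrier_mat (\<rho>\<^sub>D * m) ((\<rho>\<^sub>D + 1) * m)"
    and "strong_block_minimal_basis_pencil M\<^sub>D K\<^sub>D"
    and "dual_minimal_bases K\<^sub>D N\<^sub>D" "equal_row_degrees N\<^sub>D" "\<rho>\<^sub>D = mat_degree N\<^sub>D"
    and "M\<^sub>D * transpose_mat N\<^sub>D = D"
    and "M\<^sub>C \<in> carrier_mat p ((\<rho>\<^sub>A + 1) * n)" "linear_mat M\<^sub>C" "M\<^sub>C * transpose_mat N\<^sub>A = C"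
    and "M\<^sub>B \<in> carrier_mat n ((\<rho>\<^sub>D + 1) * m)" "linear_mat M\<^sub>B" "M\<^sub>B * transpose_mat N\<^sub>D = B"
    and "\<not> is_eigenvalue
           (rev_mat (int \<rho>\<^sub>A + 1) (rat_mat A) @\<^sub>r rev_mat (int \<rho>\<^sub>A + 1) (rat_mat C)) 0"
    and "\<not> is_eigenvalue
           (append_cols (rev_mat (int \<rho>\<^sub>A + 1) (rat_mat A)) (rev_mat (int \<rho>\<^sub>D + 1) (rat_mat B))) 0"
  shows "linearization_at_infinity (n + \<rho>\<^sub>A * n)
           (four_block_mat
              (M\<^sub>A @\<^sub>r K\<^sub>A)                  (M\<^sub>B @\<^sub>r 0\<^sub>m (\<rho>\<^sub>A * n) ((\<rho>\<^sub>D + 1) * m))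
              (- M\<^sub>C @\<^sub>r 0\<^sub>m (\<rho>\<^sub>D * m) ((\<rho>\<^sub>A + 1) * n))  (M\<^sub>D @\<^sub>r K\<^sub>D))
           R (int \<rho>\<^sub>D + 1)"
proof -
  have eA: "(\<rho>\<^sub>A + 1) * n = n + \<rho>\<^sub>A * n" and eD: "(\<rho>\<^sub>D + 1) * m = m + \<rho>\<^sub>D * m" by simp_all
  let ?sA = "\<rho>\<^sub>A * n" and ?sD = "\<rho>\<^sub>D * m"
  note A = assms(1) and B = assms(2) and C = assms(3) and D = assms(4) and R_def = assms(6)
  note MA = assms(7)[unfolded eA] and KA = assms(8)[unfolded eA]
    and MD = assms(14)[unfolded eD] and KD = assms(15)[unfolded eD]
    and MC = assms(21)[unfolded eA] and MB = assms(24)[unfolded eD]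
  have pA: "linear_mat (M\<^sub>A @\<^sub>r K\<^sub>A)" "\<forall>i < dim_row K\<^sub>A. row_degree K\<^sub>A i = 1"
    using assms(9) unfolding strong_block_minimal_basis_pencil_def by blast+
  have pD: "linear_mat (M\<^sub>D @\<^sub>r K\<^sub>D)" "\<forall>i < dim_row K\<^sub>D. row_degree K\<^sub>D i = 1"
    using assms(16) unfolding strong_block_minimal_basis_pencil_def by blast+
  note iA = dual_minimal_bases_at_infinity[OF assms(8) pA(2) assms(10-12)]
  note iD = dual_minimal_bases_at_infinity[OF assms(15) pD(2) assms(17-19)]
  have bMA: "deg_bounded 1 M\<^sub>A" and bMD: "deg_bounded 1 M\<^sub>D" and bMC: "deg_bounded 1 M\<^sub>C"
    and bMB: "deg_bounded 1 M\<^sub>B"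
    using pA(1) pD(1) assms(22,25) unfolding linear_mat_iff by (blast dest: deg_bounded_append_rowsD)+
  have NAT: "N\<^sub>A\<^sup>T \<in> carrier_mat (n + ?sA) n" and NDT: "N\<^sub>D\<^sup>T \<in> carrier_mat (m + ?sD) m"
    using iA(3) iD(3) by simp_all
  let ?gA = "1 + \<rho>\<^sub>A" and ?gD = "1 + \<rho>\<^sub>D"
  have bA: "deg_bounded ?gA A" and bC: "deg_bounded ?gA C" and bB: "deg_bounded ?gD B" and bD: "deg_bounded ?gD D"
    using deg_bounded_mult[OF MA NAT bMA iA(5)] deg_bounded_mult[OF MC NAT bMC iA(5)]
      deg_bounded_mult[OF MB NDT bMB iD(5)] deg_bounded_mult[OF MD NDT bMD iD(5)]
    unfolding assms(13,20,23,26) .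

  \<comment> \<open>A prime denotes the reversal; only its behaviour at zero matters from here on.\<close>
  define MA' KA' NA' where "MA' = rev_poly_mat 1 M\<^sub>A" and "KA' = rev_poly_mat 1 K\<^sub>A"
    and "NA' = rev_poly_mat \<rho>\<^sub>A N\<^sub>A\<^sup>T"
  define MD' KD' ND' where "MD' = rev_poly_mat 1 M\<^sub>D" and "KD' = rev_poly_mat 1 K\<^sub>D"
    and "ND' = rev_poly_mat \<rho>\<^sub>D N\<^sub>D\<^sup>T"
  define MB' MC' where "MB' = rev_poly_mat 1 M\<^sub>B" and "MC' = rev_poly_mat 1 M\<^sub>C"
  define A' B' C' D' where "A' = rev_poly_mat ?gA A" and "B' = rev_poly_mat ?gD B"
    and "C' = rev_poly_mat ?gA C" and "D' = rev_poly_mat ?gD D"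
  note defs = MA'_def KA'_def NA'_def MD'_def KD'_def ND'_def MB'_def MC'_def
  have cA': "MA' \<in> carrier_mat n (n + ?sA)" "KA' \<in> carrier_mat ?sA (n + ?sA)" "NA' \<in> carrier_mat (n + ?sA) n"
    and cD': "MD' \<in> carrier_mat p (m + ?sD)" "KD' \<in> carrier_mat ?sD (m + ?sD)" "ND' \<in> carrier_mat (m + ?sD) m"
    and cB': "MB' \<in> carrier_mat n (m + ?sD)" and cC': "MC' \<in> carrier_mat p (n + ?sA)"
    using MA KA NAT MD KD NDT MB MC by (simp_all add: defs)
  have c': "A' \<in> carrier_mat n n" "B' \<in> carrier_mat n m" "C' \<in> carrier_mat p n" "D' \<in> carrier_mat p m"
    using A B C D by (simp_all add: A'_def B'_def C'_def D'_def)
  have eqs: "A' = MA' * NA'" "C' = MC' * NA'" "B' = MB' * ND'" "D' = MD' * ND'"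
    using rev_poly_mat_mult[OF MA NAT bMA iA(5)] rev_poly_mat_mult[OF MC NAT bMC iA(5)]
      rev_poly_mat_mult[OF MB NDT bMB iD(5)] rev_poly_mat_mult[OF MD NDT bMD iD(5)]
    unfolding assms(13,20,23,26) by (simp_all only: A'_def B'_def C'_def D'_def defs)
  note iA' = iA(6-8)[folded KA'_def NA'_def] and iD' = iD(6-8)[folded KD'_def ND'_def]
  have ratA: "rat_mat A' = rev_mat (int \<rho>\<^sub>A + 1) (rat_mat A)" and ratC: "rat_mat C' = rev_mat (int \<rho>\<^sub>A + 1) (rat_mat C)"
    and ratB: "rat_mat B' = rev_mat (int \<rho>\<^sub>D + 1) (rat_mat B)" and ratD: "rat_mat D' = rev_mat (int \<rho>\<^sub>D + 1) (rat_mat D)"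
    using rat_rev_poly_mat[OF bA] rat_rev_poly_mat[OF bC] rat_rev_poly_mat[OF bB] rat_rev_poly_mat[OF bD]
    by (simp_all add: A'_def B'_def C'_def D'_def add.commute)
  have detA': "det A' \<noteq> 0" unfolding A'_def det_rev_poly_mat_eq_0_iff[OF bA] by (fact assms(5))

  have inj: "w = 0\<^sub>v n" if "w \<in> carrier_vec n" "(at0 A' @\<^sub>r at0 C') *\<^sub>v w = 0\<^sub>v (n + p)" for w
    using no_eigenvalue_0_imp_injective[OF c'(1,3) detA' _ that] assms(27) unfolding ratA ratC by blast
  have surj: "\<exists>x \<in> carrier_vec (n + m). append_cols (at0 A') (at0 B') *\<^sub>v x = y" if "y \<in> carrier_vec n" for y
    using no_eigenvalue_0_imp_surjective[OF c'(1,2) detA' _ that] assms(28) unfolding ratA ratB by blast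

  have a0: "at0 MA' \<in> carrier_mat n (n + ?sA)" "at0 KA' \<in> carrier_mat ?sA (n + ?sA)"
    "at0 NA' \<in> carrier_mat (n + ?sA) n" "at0 MC' \<in> carrier_mat p (n + ?sA)"
    "at0 MB' \<in> carrier_mat n (m + ?sD)" "at0 ND' \<in> carrier_mat (m + ?sD) m"
    using cA' cB' cC' cD' by simp_all
  have KN0: "at0 KA' * at0 NA' = 0\<^sub>m ?sA n"
    unfolding poly_0_hom.mat_hom_mult[OF cA'(2,3), symmetric] iA'(1) by (intro eq_matI) auto
  obtain X0 where X0: "X0 \<in> carrier_mat (n + ?sA) ?sA" "at0 KA' * X0 = 1\<^sub>m ?sA"
      "det (append_cols (at0 NA') X0) \<noteq> 0"
    and ker: "\<And>v. v \<in> carrier_vec (n + ?sA) \<Longrightarrow> at0 KA' *\<^sub>v v = 0\<^sub>v ?sA \<Longrightarrow> \<exists>w \<in> carrier_vec n. v = at0 NA' *\<^sub>v w"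
    using dual_completion_field[OF a0(2,3) KN0 iA'(2,3)] by blast
  have eqs0: "at0 A' = at0 MA' * at0 NA'" "at0 C' = at0 MC' * at0 NA'" "at0 B' = at0 MB' * at0 ND'"
    unfolding eqs poly_0_hom.mat_hom_mult[OF cA'(1,3)] poly_0_hom.mat_hom_mult[OF cC' cA'(3)]
      poly_0_hom.mat_hom_mult[OF cB' cD'(3)] by (rule refl)+

  let ?LA = "M\<^sub>A @\<^sub>r K\<^sub>A" and ?LB = "M\<^sub>B @\<^sub>r 0\<^sub>m ?sA (m + ?sD)"
  let ?LC = "M\<^sub>C @\<^sub>r 0\<^sub>m ?sD (n + ?sA)" and ?LD = "M\<^sub>D @\<^sub>r K\<^sub>D"
  have LA: "?LA \<in> carrier_mat (n + ?sA) (n + ?sA)" and LB: "?LB \<in> carrier_mat (n + ?sA) (m + ?sD)"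
    and LC: "?LC \<in> carrier_mat (p + ?sD) (n + ?sA)" and LD: "?LD \<in> carrier_mat (p + ?sD) (m + ?sD)"
    using MA KA MB MC MD KD by simp_all
  have bLA: "deg_bounded 1 ?LA" and bLB: "deg_bounded 1 ?LB" and bLC: "deg_bounded 1 ?LC" and bLD: "deg_bounded 1 ?LD"
    using pA(1) pD(1) bMB bMC MB MC unfolding linear_mat_iff
    by (auto intro!: deg_bounded_append_rows simp: deg_bounded_zero_mat)
  have revLA: "rev_poly_mat 1 ?LA = MA' @\<^sub>r KA'" and revLB: "rev_poly_mat 1 ?LB = MB' @\<^sub>r 0\<^sub>m ?sA (m + ?sD)"
    and revLC: "rev_poly_mat 1 ?LC = MC' @\<^sub>r 0\<^sub>m ?sD (n + ?sA)" and revLD: "rev_poly_mat 1 ?LD = MD' @\<^sub>r KD'"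
    unfolding map_mat_append_rows[OF MA KA] map_mat_append_rows[OF MB zero_carrier_mat]
      map_mat_append_rows[OF MC zero_carrier_mat] map_mat_append_rows[OF MD KD] map_mat_zero_mat[of "rev_poly 1", OF rev_poly_0] defs
    by (rule refl)+
  have ratL: "rev_mat 1 (rat_mat ?LA) = rat_mat (MA' @\<^sub>r KA')"
    "rev_mat 1 (rat_mat ?LB) = rat_mat (MB' @\<^sub>r 0\<^sub>m ?sA (m + ?sD))"
    "rev_mat 1 (rat_mat ?LC) = rat_mat (MC' @\<^sub>r 0\<^sub>m ?sD (n + ?sA))"
    "rev_mat 1 (rat_mat ?LD) = rat_mat (MD' @\<^sub>r KD')"
    using rat_rev_poly_mat[OF bLA] rat_rev_poly_mat[OF bLB] rat_rev_poly_mat[OF bLC] rat_rev_poly_mat[OF bLD]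
    unfolding revLA revLB revLC revLD by simp_all
  let ?L = "four_block_mat ?LA ?LB (- ?LC) ?LD"
  have LCneg: "- M\<^sub>C @\<^sub>r 0\<^sub>m ?sD (n + ?sA) = - ?LC"
    using MC by (intro eq_matI) (auto simp: append_rows_def)

  have detLA: "det ?LA \<noteq> 0"
  proof -
    have "det (MA' @\<^sub>r KA') \<noteq> 0"
    proof -
      let ?X = "const_mat X0"
      have X: "?X \<in> carrier_mat (n + ?sA) ?sA" using X0(1) by (rule const_mat_carrier)
      have "poly (det (KA' * ?X)) 0 = 1"
        unfolding poly_0_hom.hom_det[symmetric] poly_0_hom.mat_hom_mult[OF cA'(2) X] using X0(2) by simp
      then have "det (KA' * ?X) \<noteq> 0" by auto
      then show ?thesis using det_pencil[OF cA' X iA'(1)] detA' unfolding eqs(1) by auto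
    qed
    then show ?thesis unfolding revLA[symmetric] det_rev_poly_mat_eq_0_iff[OF bLA] .
  qed
  have linL: "linear_mat ?L"
    unfolding linear_mat_iff using LA LB LC LD bLA bLB bLC bLD
    by (intro deg_bounded_four_block) (auto simp: deg_bounded_uminus)
  \<comment> \<open>Row \<open>n\<close> of the system matrix starts with the first row of \<open>K\<^sub>A\<close>, which has degree 1.\<close>
  have degL: "mat_degree ?L \<noteq> 0"
  proof
    assume "mat_degree ?L = 0"
    then have z: "deg_bounded 0 ?L" using mat_degree_le_iff[of ?L 0] by simp
    have s0: "0 < ?sA" using iA(1,2) by simp
    have "degree (K\<^sub>A $$ (0, j)) \<le> 0" if j: "j < n + ?sA" for j
    proof -
      have "?L $$ (n, j) = K\<^sub>A $$ (0, j)"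
        using j s0 MA KA LA LB LC LD by (simp add: append_rows_def)
      moreover have "degree (?L $$ (n, j)) \<le> 0"
      proof -
        have "n < n + ?sA + (p + ?sD)" "j < n + ?sA + (m + ?sD)" using j s0 by simp_all
        then show ?thesis
          using z unfolding deg_bounded_def carrier_matD[OF four_block_carrier_mat[OF LA LD]] by blast
      qed
      ultimately show ?thesis by simp
    qed
    then have "row_degree K\<^sub>A 0 \<le> 0"
      unfolding row_degree_def vec_degree_le_iff using KA s0 by simp
    then show False using pA(2) KA s0 by simp
  qed

  have min1: "\<not> is_eigenvalue (rev_mat 1 (rat_mat ?LA) @\<^sub>r rev_mat 1 (rat_mat ?LC)) 0"
  proof -
    let ?G = "(MA' @\<^sub>r KA') @\<^sub>r (MC' @\<^sub>r 0\<^sub>m ?sD (n + ?sA))"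
    have c1: "MA' @\<^sub>r KA' \<in> carrier_mat (n + ?sA) (n + ?sA)"
      and c2: "MC' @\<^sub>r 0\<^sub>m ?sD (n + ?sA) \<in> carrier_mat (p + ?sD) (n + ?sA)" using cA' cC' by simp_all
    have G: "?G \<in> carrier_mat ((n + ?sA) + (p + ?sD)) (n + ?sA)" using c1 c2 by (rule carrier_append_rows)
    have G0: "at0 ?G = (at0 MA' @\<^sub>r at0 KA') @\<^sub>r (at0 MC' @\<^sub>r 0\<^sub>m ?sD (n + ?sA))"
      unfolding map_mat_append_rows[OF c1 c2] map_mat_append_rows[OF cA'(1,2)]
        map_mat_append_rows[OF cC' zero_carrier_mat] by (simp add: map_mat_zero_mat)
    have "mat_rank (at0 ?G) = n + ?sA"
    proof (subst mat_rank_eq_dim_col_iff)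
      show "at0 ?G \<in> carrier_mat ((n + ?sA) + (p + ?sD)) (n + ?sA)" using G by simp
      show "\<forall>v\<in>carrier_vec (n + ?sA). at0 ?G *\<^sub>v v = 0\<^sub>v ((n + ?sA) + (p + ?sD)) \<longrightarrow> v = 0\<^sub>v (n + ?sA)"
        unfolding G0
        using pencil_state_output_injective[OF a0(1,2,3,4) ker inj[unfolded eqs0]] by blast
    qed
    moreover have "mat_rank (rat_mat ?G) \<le> n + ?sA" using G by (intro mat_rank_le_dim_col) simp
    ultimately show ?thesis
      unfolding ratL map_mat_append_rows[OF c1 c2, symmetric] is_eigenvalue_rat_mat_iff by simp
  qed
  have min2: "\<not> is_eigenvalue (append_cols (rev_mat 1 (rat_mat ?LA)) (rev_mat 1 (rat_mat ?LB))) 0"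
  proof -
    let ?G = "append_cols (MA' @\<^sub>r KA') (MB' @\<^sub>r 0\<^sub>m ?sA (m + ?sD))"
    have c1: "MA' @\<^sub>r KA' \<in> carrier_mat (n + ?sA) (n + ?sA)"
      and c2: "MB' @\<^sub>r 0\<^sub>m ?sA (m + ?sD) \<in> carrier_mat (n + ?sA) (m + ?sD)" using cA' cB' by simp_all
    have G: "?G \<in> carrier_mat (n + ?sA) ((n + ?sA) + (m + ?sD))" using c1 c2 by (rule append_cols_carrier)
    have G0: "at0 ?G = append_cols (at0 MA' @\<^sub>r at0 KA') (at0 MB' @\<^sub>r 0\<^sub>m ?sA (m + ?sD))"
      unfolding map_mat_append_cols[OF c1 c2] map_mat_append_rows[OF cA'(1,2)]
        map_mat_append_rows[OF cB' zero_carrier_mat] by (simp add: map_mat_zero_mat)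
    have "mat_rank (at0 ?G) = n + ?sA"
    proof (subst mat_rank_eq_dim_row_iff)
      show "at0 ?G \<in> carrier_mat (n + ?sA) ((n + ?sA) + (m + ?sD))" using G by simp
      show "\<forall>y\<in>carrier_vec (n + ?sA). \<exists>x\<in>carrier_vec ((n + ?sA) + (m + ?sD)). at0 ?G *\<^sub>v x = y"
        unfolding G0
        using pencil_state_input_surjective[OF a0(1,2,3) KN0 X0(1,2) a0(5,6) surj[unfolded eqs0]] by blast
    qed
    moreover have "mat_rank (rat_mat ?G) \<le> n + ?sA" using G by (intro mat_rank_le_dim_row) simp
    ultimately show ?thesis
      unfolding ratL map_mat_append_cols[OF c1 c2, symmetric] is_eigenvalue_rat_mat_iff by simp
  qed

  have rA: "rat_mat A \<in> carrier_mat n n" and rB: "rat_mat B \<in> carrier_mat n m"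
    and rC: "rat_mat C \<in> carrier_mat p n" and rD: "rat_mat D \<in> carrier_mat p m" using A B C D by simp_all
  have "det (rat_mat A) \<noteq> 0" using assms(5) by (simp add: to_fract_hom.hom_det)
  then obtain Ai where Ai: "Ai \<in> carrier_mat n n" "rat_mat A * Ai = 1\<^sub>m n" "Ai * rat_mat A = 1\<^sub>m n"
    "mat_inverse (rat_mat A) = Some Ai"
    using inverse_if_det_nonzero[OF rA] by blast
  define Ai' where "Ai' = rev_mat (- (int \<rho>\<^sub>A + 1)) Ai"
  have Ai': "Ai' \<in> carrier_mat n n" unfolding Ai'_def using Ai(1) by (rule rev_mat_carrier)
  have AiA': "Ai' * rat_mat A' = 1\<^sub>m n" "rat_mat A' * Ai' = 1\<^sub>m n"
    using rev_mat_inverse[OF Ai(1) rA Ai(3), of "- (int \<rho>\<^sub>A + 1)"] rev_mat_inverse[OF rA Ai(1,2), of "int \<rho>\<^sub>A + 1"]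
    unfolding Ai'_def ratA minus_minus .
  have revR: "rev_mat (int \<rho>\<^sub>D + 1) R = rat_mat D' + rat_mat C' * Ai' * rat_mat B'"
    unfolding R_def Ai(4) option.sel ratB ratC ratD Ai'_def
    using rA rB rC rD Ai(1) by (rule rev_mat_transfer_function) simp

  have rLA: "rat_mat ?LA \<in> carrier_mat (n + ?sA) (n + ?sA)" and rLB: "rat_mat ?LB \<in> carrier_mat (n + ?sA) (m + ?sD)"
    and rLC: "rat_mat ?LC \<in> carrier_mat (p + ?sD) (n + ?sA)" and rLD: "rat_mat ?LD \<in> carrier_mat (p + ?sD) (m + ?sD)"
    using LA LB LC LD by simp_all
  have "det (rat_mat ?LA) \<noteq> 0" using detLA by (simp add: to_fract_hom.hom_det)
  then obtain Li where Li: "Li \<in> carrier_mat (n + ?sA) (n + ?sA)" "Li * rat_mat ?LA = 1\<^sub>m (n + ?sA)"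
    "mat_inverse (rat_mat ?LA) = Some Li"
    using inverse_if_det_nonzero[OF rLA] by blast
  define Li' where "Li' = rev_mat (- 1) Li"
  have Li': "Li' \<in> carrier_mat (n + ?sA) (n + ?sA)" unfolding Li'_def using Li(1) by (rule rev_mat_carrier)
  have "Li' * rev_mat 1 (rat_mat ?LA) = 1\<^sub>m (n + ?sA)"
    using rev_mat_inverse[OF Li(1) rLA Li(2), of "- 1"] unfolding Li'_def by simp
  then have LiL: "Li' * (rat_mat MA' @\<^sub>r rat_mat KA') = 1\<^sub>m (n + ?sA)"
    unfolding ratL map_mat_append_rows[OF cA'(1,2)] .
  have q: "rat_mat MA' \<in> carrier_mat n (n + ?sA)" "rat_mat KA' \<in> carrier_mat ?sA (n + ?sA)"
    "rat_mat NA' \<in> carrier_mat (n + ?sA) n" "rat_mat MB' \<in> carrier_mat n (m + ?sD)"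
    "rat_mat MC' \<in> carrier_mat p (n + ?sA)" "rat_mat MD' \<in> carrier_mat p (m + ?sD)"
    "rat_mat KD' \<in> carrier_mat ?sD (m + ?sD)"
    using cA' cB' cC' cD' by simp_all
  have qKN: "rat_mat KA' * rat_mat NA' = 0\<^sub>m ?sA n"
    unfolding to_fract_hom.mat_hom_mult[OF cA'(2,3), symmetric] iA'(1) by (rule map_mat_zero_mat) simp
  have qA: "rat_mat A' = rat_mat MA' * rat_mat NA'" and qC: "rat_mat C' = rat_mat MC' * rat_mat NA'"
    unfolding eqs(1,2) to_fract_hom.mat_hom_mult[OF cA'(1,3)] to_fract_hom.mat_hom_mult[OF cC' cA'(3)] by (rule refl)+
  have zq: "rat_mat (0\<^sub>m r c) = 0\<^sub>m r c" for r c by (rule map_mat_zero_mat) simp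
  have revT: "rev_mat 1 (transfer_function ?LA ?LB ?LC ?LD)
    = (rat_mat MD' + rat_mat C' * Ai' * rat_mat MB') @\<^sub>r rat_mat KD'"
  proof -
    have "rev_mat 1 (transfer_function ?LA ?LB ?LC ?LD) = rev_mat 1 (rat_mat ?LD)
        + rev_mat 1 (rat_mat ?LC) * Li' * rev_mat 1 (rat_mat ?LB)"
      unfolding transfer_function_def Li(3) option.sel Li'_def
      using rLA rLB rLC rLD Li(1) by (rule rev_mat_transfer_function) simp
    also have "\<dots> = (rat_mat MD' @\<^sub>r rat_mat KD')
        + (rat_mat MC' @\<^sub>r 0\<^sub>m ?sD (n + ?sA)) * Li' * (rat_mat MB' @\<^sub>r 0\<^sub>m ?sA (m + ?sD))"
      unfolding ratL map_mat_append_rows[OF cD'(1,2)] map_mat_append_rows[OF cC' zero_carrier_mat]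
        map_mat_append_rows[OF cB' zero_carrier_mat] zq ..
    also have "\<dots> = (rat_mat MD' + rat_mat C' * Ai' * rat_mat MB') @\<^sub>r rat_mat KD'"
      by (rule pencil_transfer_function[OF q(1-3) qKN qA qC q(4-7) Li' LiL Ai' AiA'(2)])
    finally show ?thesis .
  qed
  have equiv: "\<exists>Q\<^sub>1 \<in> carrier_mat (p + ?sD) (p + ?sD). \<exists>Q\<^sub>2 \<in> carrier_mat (m + ?sD) (m + ?sD).
    regular_at_zero Q\<^sub>1 \<and> regular_at_zero Q\<^sub>2 \<and>
    Q\<^sub>1 * four_block_mat (rev_mat (int \<rho>\<^sub>D + 1) R) (0\<^sub>m p ?sD) (0\<^sub>m ?sD m) (1\<^sub>m ?sD) * Q\<^sub>2
      = rev_mat 1 (transfer_function ?LA ?LB ?LC ?LD)"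
    unfolding revR revT
    using transfer_function_equivalence_at_zero[OF c'(1) eqs(3) c'(3) eqs(4) cB' cD' iD' surj Ai' AiA'(1)] .

  have dimR: "dim_row R = p" "dim_col R = m" using assms(6) rC rB by simp_all
  show ?thesis
    unfolding linearization_at_infinity_def Let_def dimR eA eD LCneg
    using LA LB LC LD linL degL iA(1) detLA min1 min2 equiv
    by (intro exI[of _ ?sD] exI[of _ ?LA] exI[of _ ?LB] exI[of _ ?LC] exI[of _ ?LD]) simp
qed

end
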